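(* Let $(Y,\mathrm{d}_Y,g)$ satisfy Wieler's axioms with associated Wieler solenoid $(X,\varphi)$, let $\mathbf{P}$ be a finite $\varphi$-invariant set of periodic points of $\varphi$, and let $\tilde{g}: X^u(\mathbf{P})/{\sim_0}\to X^u(\mathbf{P})/{\sim_0}$ and $r:X^u(\mathbf{P})/{\sim_0}\to Y$ be the maps defined in the context. Then the dynamical system $(X^u(\mathbf{P})/{\sim_0},\tilde{g})$ is forward orbit expansive. Moreover, $\tilde{g}$ is a local homeomorphism, and there exists $L\in\mathbb{N}$ such that for each $y\in Y$ the set $\tilde{g}^L(r^{-1}(y))$ is a singleton.
   Context: $\mathbb{N}=\{0,1,2,\dots\}$. Wieler's axioms: $(Y,\mathrm{d}_Y)$ is an infinite compact metric space, $g:Y\to Y$ is a continuous surjection, and there are $\beta>0$, $K\in\mathbb{N}^+$, $0<\gamma<1$ with (Axiom 1) if $\mathrm{d}_Y(x,y)\le\beta$ then $\mathrm{d}_Y(g^K(x),g^K(y))\le\gamma^K\mathrm{d}_Y(g^{2K}(x),g^{2K}(y))$; (Axiom 2) $g^K(B(g^K(x),\epsilon))\subseteq g^{2K}(B(x,\gamma\epsilon))$ for all $x\in Y$, $0<\epsilon\le\beta$. The Wieler solenoid is $X=\{\mathbf{x}=(x_n)_{n\in\mathbb{N}}: x_n\in Y,\ g(x_{n+1})=x_n\}$ with homeomorphism $\varphi(x_0,x_1,\dots)=(g(x_0),x_0,x_1,\dots)$ and metric $\mathrm{d}_X(\mathbf{x},\mathbf{y})=\sum_{i=0}^K\gamma^i\mathrm{d}'_X(\varphi^i(\mathbf{x}),\varphi^i(\mathbf{y}))$,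 $\mathrm{d}'_X(\mathbf{x},\mathbf{y})=\sup_n\gamma^n\mathrm{d}_Y(x_n,y_n)$ (inducing the product topology). Write $\mathbf{x}\sim_u\mathbf{y}$ if $\mathrm{d}_X(\varphi^{-n}(\mathbf{x}),\varphi^{-n}(\mathbf{y}))\to0$ as $n\to\infty$. Put $X^u(\mathbf{P})=\{\mathbf{x}\in X:\mathbf{x}\sim_u\mathbf{p}\text{ for some }\mathbf{p}\in\mathbf{P}\}$ and, for $0<\epsilon\le\beta/2$, $X^u(\mathbf{x},\epsilon)=\{\mathbf{y}\in X:\mathrm{d}_Y(x_n,y_n)<\epsilon\ \forall n,\ \mathrm{d}_X(\mathbf{x},\mathbf{y})<\epsilon\}$. $X^u(\mathbf{P})$ carries the locally compact Hausdorff topology for which the sets $X^u(\mathbf{x},\epsilon)$ form a neighbourhood base at $\mathbf{x}$. Let $\pi_0:X^u(\mathbf{P})\to Y$, $\pi_0(\mathbf{x})=x_0$. Fix a sufficiently small constant $0<\epsilon_Y\le\beta/2$ (so that $\pi_0$ is injective on each $X^u(\mathbf{z},\epsilon_Y)$). For $\mathbf{x},\mathbf{y}\in X^u(\mathbf{P})$, $\mathbf{x}\sim_0\mathbf{y}$ means: $x_0=y_0$ and there are $0<\delta<\epsilon_Y$ and an open $U\subseteq X^u(\mathbf{y},\epsilon_Y)$ with $\pi_0(X^u(\mathbf{x},\delta))=\pi_0(U)$. This is an equivalence relation; $X^u(\mathbf{P})/{\sim_0}$ has the quotient topology (possibly non-Hausdorff). The maps $\tilde{g}([\mathbf{x}]_0)=[\varphi(\mathbf{x})]_0$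 and $r([\mathbf{x}]_0)=x_0$ are well defined and $r\circ\tilde g=g\circ r$. It is taken as known that $X^u(\mathbf{P})/{\sim_0}$ is compact and that $r$ is a continuous surjection. A pair $(\tilde{Y},\tilde{g})$ ($\tilde Y$ a compact, possibly non-Hausdorff space, $\tilde g:\tilde Y\to\tilde Y$ a continuous surjection) is forward orbit expansive if there is a finite open cover $\mathcal{U}$ of $\tilde{Y}$ such that whenever $x,y\in\tilde{Y}$ are such that for each $n\in\mathbb{N}$ some member of $\mathcal{U}$ contains both $\tilde{g}^n(x)$ and $\tilde{g}^n(y)$, then $x=y$. *)

theory Defs
  imports "HOL-Analysis.Analysis"
begin

section \<open>Wieler's axioms and the solenoid\<close>

text \<open>The compact metric space is the whole type; balls are open balls.\<close>

definition wieler :: "('a::metric_space \<Rightarrow> 'a) \<Rightarrow> real \<Rightarrow> nat \<Rightarrow> real \<Rightarrow> bool" where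
  "wieler g \<beta> K \<gamma> \<longleftrightarrow>
     infinite (UNIV :: 'a set) \<and> compact (UNIV :: 'a set) \<and>
     continuous_on UNIV g \<and> surj g \<and>
     0 < \<beta> \<and> 0 < K \<and> 0 < \<gamma> \<and> \<gamma> < 1 \<and>
     (\<forall>x y. dist x y \<le> \<beta> \<longrightarrow>
        dist ((g ^^ K) x) ((g ^^ K) y) \<le> \<gamma> ^ K * dist ((g ^^ (2 * K)) x) ((g ^^ (2 * K)) y)) \<and>
     (\<forall>x \<epsilon>. 0 < \<epsilon> \<and> \<epsilon> \<le> \<beta> \<longrightarrow>
        (g ^^ K) ` ball ((g ^^ K) x) \<epsilon> \<subseteq> (g ^^ (2 * K)) ` ball x (\<gamma> * \<epsilon>))"

definition solenoid :: "('a \<Rightarrow> 'a) \<Rightarrow> (nat \<Rightarrow> 'a) set" where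
  "solenoid g = {x. \<forall>n. g (x (Suc n)) = x n}"

definition phi :: "('a \<Rightarrow> 'a) \<Rightarrow> (nat \<Rightarrow> 'a) \<Rightarrow> nat \<Rightarrow> 'a" where
  "phi g x = (\<lambda>n. case n of 0 \<Rightarrow> g (x 0) | Suc m \<Rightarrow> x m)"

lemma bij_betw_phi: "bij_betw (phi g) (solenoid g) (solenoid g)"
proof (rule bij_betw_byWitness[where f' = "\<lambda>x n. x (Suc n)"])
  show "\<forall>x\<in>solenoid g. (\<lambda>n. phi g x (Suc n)) = x"
    by (simp add: phi_def)
  show "\<forall>x\<in>solenoid g. phi g (\<lambda>n. x (Suc n)) = x"
    by (auto simp: phi_def solenoid_def fun_eq_iff split: nat.split)
  show "phi g ` solenoid g \<subseteq> solenoid g"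
    by (auto simp: phi_def solenoid_def split: nat.split)
  show "(\<lambda>x n. x (Suc n)) ` solenoid g \<subseteq> solenoid g"
    by (auto simp: solenoid_def)
qed

abbreviation phi_inv :: "('a \<Rightarrow> 'a) \<Rightarrow> (nat \<Rightarrow> 'a) \<Rightarrow> nat \<Rightarrow> 'a" where
  "phi_inv g \<equiv> inv_into (solenoid g) (phi g)"

definition dX' :: "real \<Rightarrow> (nat \<Rightarrow> 'a::metric_space) \<Rightarrow> (nat \<Rightarrow> 'a) \<Rightarrow> real" where
  "dX' \<gamma> x y = (SUP n. \<gamma> ^ n * dist (x n) (y n))"

definition dX :: "('a::metric_space \<Rightarrow> 'a) \<Rightarrow> nat \<Rightarrow> real \<Rightarrow> (nat \<Rightarrow> 'a) \<Rightarrow> (nat \<Rightarrow> 'a) \<Rightarrow> real" where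
  "dX g K \<gamma> x y = (\<Sum>i=0..K. \<gamma> ^ i * dX' \<gamma> ((phi g ^^ i) x) ((phi g ^^ i) y))"

section \<open>The unstable set and its topology\<close>

definition unstably_equiv ::
  "('a::metric_space \<Rightarrow> 'a) \<Rightarrow> nat \<Rightarrow> real \<Rightarrow> (nat \<Rightarrow> 'a) \<Rightarrow> (nat \<Rightarrow> 'a) \<Rightarrow> bool" where
  "unstably_equiv g K \<gamma> x y \<longleftrightarrow>
     (\<lambda>n. dX g K \<gamma> ((phi_inv g ^^ n) x) ((phi_inv g ^^ n) y)) \<longlonglongrightarrow> 0"

definition Xu ::
  "('a::metric_space \<Rightarrow> 'a) \<Rightarrow> nat \<Rightarrow> real \<Rightarrow> (nat \<Rightarrow> 'a) set \<Rightarrow> (nat \<Rightarrow> 'a) set" where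
  "Xu g K \<gamma> P = {x \<in> solenoid g. \<exists>p\<in>P. unstably_equiv g K \<gamma> x p}"

definition Xu_loc ::
  "('a::metric_space \<Rightarrow> 'a) \<Rightarrow> nat \<Rightarrow> real \<Rightarrow> (nat \<Rightarrow> 'a) \<Rightarrow> real \<Rightarrow> (nat \<Rightarrow> 'a) set" where
  "Xu_loc g K \<gamma> x \<epsilon> = {y \<in> solenoid g. (\<forall>n. dist (x n) (y n) < \<epsilon>) \<and> dX g K \<gamma> x y < \<epsilon>}"

definition openin_Xu ::
  "('a::metric_space \<Rightarrow> 'a) \<Rightarrow> real \<Rightarrow> nat \<Rightarrow> real \<Rightarrow> (nat \<Rightarrow> 'a) set \<Rightarrow> (nat \<Rightarrow> 'a) set \<Rightarrow> bool" where
  "openin_Xu g \<beta> K \<gamma> P U \<longleftrightarrow>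
     U \<subseteq> Xu g K \<gamma> P \<and> (\<forall>x\<in>U. \<exists>\<epsilon>. 0 < \<epsilon> \<and> \<epsilon> \<le> \<beta> / 2 \<and> Xu_loc g K \<gamma> x \<epsilon> \<subseteq> U)"

definition Xu_top ::
  "('a::metric_space \<Rightarrow> 'a) \<Rightarrow> real \<Rightarrow> nat \<Rightarrow> real \<Rightarrow> (nat \<Rightarrow> 'a) set \<Rightarrow> (nat \<Rightarrow> 'a) topology" where
  "Xu_top g \<beta> K \<gamma> P = topology (openin_Xu g \<beta> K \<gamma> P)"

lemma Xu_loc_mono: "\<delta> \<le> \<epsilon> \<Longrightarrow> Xu_loc g K \<gamma> x \<delta> \<subseteq> Xu_loc g K \<gamma> x \<epsilon>"
  unfolding Xu_loc_def by (blast intro: less_le_trans)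

lemma istopology_openin_Xu: "istopology (openin_Xu g \<beta> K \<gamma> P)"
  unfolding istopology_def
proof (intro conjI allI impI)
  fix S T assume S: "openin_Xu g \<beta> K \<gamma> P S" and T: "openin_Xu g \<beta> K \<gamma> P T"
  show "openin_Xu g \<beta> K \<gamma> P (S \<inter> T)"
    unfolding openin_Xu_def
  proof (intro conjI ballI)
    show "S \<inter> T \<subseteq> Xu g K \<gamma> P"
      using S by (auto simp: openin_Xu_def)
    fix x assume x: "x \<in> S \<inter> T"
    obtain a where a: "0 < a" "a \<le> \<beta> / 2" "Xu_loc g K \<gamma> x a \<subseteq> S"
      using S x unfolding openin_Xu_def by blast
    obtain b where b: "0 < b" "b \<le> \<beta> / 2" "Xu_loc g K \<gamma> x b \<subseteq> T"
      using T x unfolding openin_Xu_def by blast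
    have "Xu_loc g K \<gamma> x (min a b) \<subseteq> S \<inter> T"
      using a(3) b(3) Xu_loc_mono[of "min a b" a g K \<gamma> x] Xu_loc_mono[of "min a b" b g K \<gamma> x]
      by auto
    then show "\<exists>\<epsilon>. 0 < \<epsilon> \<and> \<epsilon> \<le> \<beta> / 2 \<and> Xu_loc g K \<gamma> x \<epsilon> \<subseteq> S \<inter> T"
      using a b by (intro exI[of _ "min a b"]) auto
  qed
next
  fix \<K> assume *: "\<forall>S\<in>\<K>. openin_Xu g \<beta> K \<gamma> P S"
  show "openin_Xu g \<beta> K \<gamma> P (\<Union>\<K>)"
    unfolding openin_Xu_def
  proof (intro conjI ballI)
    show "\<Union>\<K> \<subseteq> Xu g K \<gamma> P"
      using * by (auto simp: openin_Xu_def)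
    fix x assume "x \<in> \<Union>\<K>"
    then obtain S where "S \<in> \<K>" "x \<in> S" by blast
    with * obtain a where "0 < a" "a \<le> \<beta> / 2" "Xu_loc g K \<gamma> x a \<subseteq> S"
      unfolding openin_Xu_def by blast
    with \<open>S \<in> \<K>\<close> show "\<exists>\<epsilon>. 0 < \<epsilon> \<and> \<epsilon> \<le> \<beta> / 2 \<and> Xu_loc g K \<gamma> x \<epsilon> \<subseteq> \<Union>\<K>"
      by blast
  qed
qed

lemma openin_Xu_top: "openin (Xu_top g \<beta> K \<gamma> P) = openin_Xu g \<beta> K \<gamma> P"
  by (simp add: Xu_top_def istopology_openin_Xu)

section \<open>The quotient\<close>

definition pi0 :: "(nat \<Rightarrow> 'a) \<Rightarrow> 'a" where
  "pi0 x = x 0"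

definition sim0 ::
  "('a::metric_space \<Rightarrow> 'a) \<Rightarrow> real \<Rightarrow> nat \<Rightarrow> real \<Rightarrow> (nat \<Rightarrow> 'a) set \<Rightarrow> real
     \<Rightarrow> ((nat \<Rightarrow> 'a) \<times> (nat \<Rightarrow> 'a)) set" where
  "sim0 g \<beta> K \<gamma> P \<epsilon>Y =
     {(x, y). x \<in> Xu g K \<gamma> P \<and> y \<in> Xu g K \<gamma> P \<and> x 0 = y 0 \<and>
        (\<exists>\<delta> U. 0 < \<delta> \<and> \<delta> < \<epsilon>Y \<and> openin (Xu_top g \<beta> K \<gamma> P) U \<and> U \<subseteq> Xu_loc g K \<gamma> y \<epsilon>Y \<and>
               pi0 ` Xu_loc g K \<gamma> x \<delta> = pi0 ` U)}"

definition quotient_topology :: "'b topology \<Rightarrow> ('b \<times> 'b) set \<Rightarrow> 'b set topology" where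
  "quotient_topology T R =
     topology (\<lambda>V. V \<subseteq> topspace T // R \<and> openin T {x \<in> topspace T. R `` {x} \<in> V})"

lemma openin_quotient_topology:
  "openin (quotient_topology T R) V \<longleftrightarrow>
     V \<subseteq> topspace T // R \<and> openin T {x \<in> topspace T. R `` {x} \<in> V}"
proof -
  have "istopology (\<lambda>V. V \<subseteq> topspace T // R \<and> openin T {x \<in> topspace T. R `` {x} \<in> V})"
    unfolding istopology_def
  proof (intro conjI allI impI; (elim conjE)?)
    fix A B assume "openin T {x \<in> topspace T. R `` {x} \<in> A}" "openin T {x \<in> topspace T. R `` {x} \<in> B}"
    then have "openin T ({x \<in> topspace T. R `` {x} \<in> A} \<inter> {x \<in> topspace T. R `` {x} \<in> B})"
      by blast
    then show "openin T {x \<in> topspace T. R `` {x} \<in> A \<inter> B}"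
      by (rule back_subst[of "openin T"]) auto
  next
    fix \<K> assume *: "\<forall>V\<in>\<K>. V \<subseteq> topspace T // R \<and> openin T {x \<in> topspace T. R `` {x} \<in> V}"
    then have "openin T (\<Union>V\<in>\<K>. {x \<in> topspace T. R `` {x} \<in> V})"
      by blast
    then show "openin T {x \<in> topspace T. R `` {x} \<in> \<Union>\<K>}"
      by (rule back_subst[of "openin T"]) auto
  qed auto
  then show ?thesis
    by (simp add: quotient_topology_def)
qed

lemma topspace_quotient_topology: "topspace (quotient_topology T R) = topspace T // R"
proof -
  have "{x \<in> topspace T. R `` {x} \<in> topspace T // R} = topspace T"
    by (auto intro: quotientI)
  then have "openin (quotient_topology T R) (topspace T // R)"
    by (simp add: openin_quotient_topology)
  then show ?thesis
    by (metis openin_quotient_topology openin_subset openin_topspace subset_antisym)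
qed

definition Xu_mod ::
  "('a::metric_space \<Rightarrow> 'a) \<Rightarrow> real \<Rightarrow> nat \<Rightarrow> real \<Rightarrow> (nat \<Rightarrow> 'a) set \<Rightarrow> real
     \<Rightarrow> (nat \<Rightarrow> 'a) set topology" where
  "Xu_mod g \<beta> K \<gamma> P \<epsilon>Y = quotient_topology (Xu_top g \<beta> K \<gamma> P) (sim0 g \<beta> K \<gamma> P \<epsilon>Y)"

text \<open>Both maps act on equivalence classes: when the representative does not matter,
  \<open>g_tilde\<close> sends the class of \<open>x\<close> to the class of \<open>phi g x\<close>, and \<open>r_map\<close> sends it to \<open>x 0\<close>.\<close>

definition g_tilde ::
  "('a::metric_space \<Rightarrow> 'a) \<Rightarrow> real \<Rightarrow> nat \<Rightarrow> real \<Rightarrow> (nat \<Rightarrow> 'a) set \<Rightarrow> real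
     \<Rightarrow> (nat \<Rightarrow> 'a) set \<Rightarrow> (nat \<Rightarrow> 'a) set" where
  "g_tilde g \<beta> K \<gamma> P \<epsilon>Y C = sim0 g \<beta> K \<gamma> P \<epsilon>Y `` (phi g ` C)"

definition r_map :: "(nat \<Rightarrow> 'a) set \<Rightarrow> 'a" where
  "r_map C = the_elem (pi0 ` C)"

section \<open>Dynamical notions\<close>

definition forward_orbit_expansive :: "'b topology \<Rightarrow> ('b \<Rightarrow> 'b) \<Rightarrow> bool" where
  "forward_orbit_expansive T f \<longleftrightarrow>
     compact_space T \<and> continuous_map T T f \<and> f ` topspace T = topspace T \<and>
     (\<exists>\<U>. finite \<U> \<and> (\<forall>U\<in>\<U>. openin T U) \<and> \<Union>\<U> = topspace T \<and>
        (\<forall>x\<in>topspace T. \<forall>y\<in>topspace T.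
           (\<forall>n. \<exists>U\<in>\<U>. (f ^^ n) x \<in> U \<and> (f ^^ n) y \<in> U) \<longrightarrow> x = y))"

definition local_homeomorphism_map :: "'b topology \<Rightarrow> 'c topology \<Rightarrow> ('b \<Rightarrow> 'c) \<Rightarrow> bool" where
  "local_homeomorphism_map S T f \<longleftrightarrow>
     (\<forall>x\<in>topspace S. \<exists>U. x \<in> U \<and> openin S U \<and> openin T (f ` U) \<and>
        homeomorphic_map (subtopology S U) (subtopology T (f ` U)) f)"

end

theory Submission
  imports Defs
begin

text \<open>By Axiom 1, sequences in the solenoid that stay \<open>\<beta>\<close>-close contract backwards, so the topology of
  the unstable set is that of the uniform distance, and on a uniformly \<open>\<beta>\<close>-small set this distance
  is controlled by the zeroth coordinate alone. Hence \<open>x\<close> and \<open>y\<close> are identified exactly when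
  \<open>x 0 = y 0\<close> and the projections of small neighbourhoods of \<open>x\<close> and \<open>y\<close> have the same germ.
  Axiom 2, iterated along the inverse limit, lifts \<open>g\<^sup>K\<close> of a ball around \<open>x K\<close> into the
  projection of a neighbourhood of \<open>x\<close>. Therefore the class of \<open>x\<close> depends only, and
  continuously, on \<open>x K\<close>: this makes the quotient a continuous image of \<open>Y\<close>, hence compact, and
  shows that \<open>L = K\<close> works, since the coordinate \<open>K\<close> of the \<open>K\<close>-th shift of \<open>x\<close> is \<open>x 0\<close>.
  The quotient map is open and locally injective, so the shift induces a local homeomorphism.
  For expansivity, use the cover by the classes of balls of radius \<open>\<beta> / 2\<close>: two orbits
  that are never separated have \<open>\<beta>\<close>-close representatives whose full forward orbits are
  \<open>\<beta>\<close>-close, and Axiom 1 forces these to coincide.\<close>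

section \<open>The shift on sequences\<close>

lemma phi_pow_apply: "(phi g ^^ i) x n = (if n < i then (g ^^ (i - n)) (x 0) else x (n - i))"
proof (induction i arbitrary: n)
  case (Suc i)
  have "(phi g ^^ Suc i) x n =
      (case n of 0 \<Rightarrow> g ((phi g ^^ i) x 0) | Suc m \<Rightarrow> (phi g ^^ i) x m)"
    by (simp add: phi_def[of g "(phi g ^^ i) x"])
  then show ?case
    by (cases n) (auto simp: Suc.IH)
qed simp

lemma phi_pow_0: "(phi g ^^ n) x 0 = (g ^^ n) (x 0)"
  by (subst phi_pow_apply) simp

lemma phi_pow_at: "(phi g ^^ n) x n = x 0"
  by (simp add: phi_pow_apply)

lemma solenoid_pow:
  assumes "x \<in> solenoid g"
  shows "(g ^^ k) (x (n + k)) = x n"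
  using assms by (induction k) (auto simp: solenoid_def funpow_swap1)

lemma solenoid_shift: "x \<in> solenoid g \<Longrightarrow> (\<lambda>n. x (m + n)) \<in> solenoid g"
  by (simp add: solenoid_def)

lemma phi_in_solenoid: "x \<in> solenoid g \<Longrightarrow> phi g x \<in> solenoid g"
  using bij_betw_phi by (blast dest: bij_betwE)

lemma phi_shift: "x \<in> solenoid g \<Longrightarrow> phi g (\<lambda>n. x (Suc n)) = x"
  by (auto simp: phi_def solenoid_def fun_eq_iff split: nat.split)

text \<open>\<open>phi_inv\<close> is an \<open>inv_into\<close>, so it is meaningful only on the
  solenoid; there it is the left shift, because \<open>phi g\<close> restores a dropped zeroth
  coordinate.\<close>

lemma phi_inv_pow:
  assumes "x \<in> solenoid g"
  shows "(phi_inv g ^^ n) x = (\<lambda>m. x (n + m))"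
proof (induction n)
  case (Suc n)
  let ?y = "\<lambda>m. x (n + m)" and ?z = "\<lambda>m. x (Suc n + m)"
  have "phi g ?z = ?y"
    using phi_shift[OF solenoid_shift[OF assms, of n]] by simp
  moreover have "?z \<in> solenoid g"
    by (rule solenoid_shift[OF assms])
  ultimately have "phi_inv g ?y = ?z"
    using bij_betw_phi[of g] by (metis bij_betw_def inv_into_f_f)
  then show ?case
    by (simp add: Suc.IH)
qed simp

text \<open>Without an upper bound the supremum in \<open>dX'\<close> would be an unspecified value;
  the diameter supplies one.\<close>

lemma dX'_bdd:
  assumes "bounded (UNIV :: 'a::metric_space set)" "0 \<le> \<gamma>" "\<gamma> \<le> 1"
  shows "bdd_above (range (\<lambda>n. \<gamma> ^ n * dist (x n) (y n :: 'a)))"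
proof -
  obtain B where B: "\<And>a b :: 'a. dist a b \<le> B"
    using assms(1) unfolding bounded_two_points by blast
  show ?thesis
    by (rule bdd_aboveI[of _ B])
       (use B assms in \<open>auto intro!: order_trans[OF mult_left_le_one_le] power_le_one\<close>)
qed

locale wieler_solenoid =
  fixes g :: "'a::metric_space \<Rightarrow> 'a" and \<beta> :: real and K :: nat and \<gamma> :: real
    and P :: "(nat \<Rightarrow> 'a) set"
  assumes wieler: "wieler g \<beta> K \<gamma>"
    and P_solenoid: "P \<subseteq> solenoid g"
    and phi_P: "phi g ` P = P"
begin

lemma beta_pos: "0 < \<beta>" and K_pos: "0 < K" and gamma_pos: "0 < \<gamma>" and gamma_less: "\<gamma> < 1"
  and compact_UNIV_Y: "compact (UNIV :: 'a set)" and cont_g: "continuous_on UNIV g"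
  using wieler by (auto simp: wieler_def)

text \<open>The contraction obtained from Axiom 1 sits at multiples of \<open>K\<close>; coordinate
  \<open>n\<close> is reached from the multiple found here by at most \<open>K\<close> applications
  of \<open>g\<close>.\<close>

lemma next_multiple:
  obtains j where "n \<le> K * j" "K * j - n \<le> K"
proof (rule that[of "Suc (n div K)"])
  have "K * (n div K) + n mod K = n" "n mod K < K"
    using K_pos by simp_all
  then show "n \<le> K * Suc (n div K)" "K * Suc (n div K) - n \<le> K"
    unfolding mult_Suc_right by linarith+
qed

lemma axiom1:
  "dist x y \<le> \<beta> \<Longrightarrow> dist ((g ^^ K) x) ((g ^^ K) y) \<le> \<gamma> ^ K * dist ((g ^^ (2 * K)) x) ((g ^^ (2 * K)) y)"
  using wieler by (auto simp: wieler_def)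

lemma axiom2:
  "0 < \<epsilon> \<Longrightarrow> \<epsilon> \<le> \<beta> \<Longrightarrow> (g ^^ K) ` ball ((g ^^ K) x) \<epsilon> \<subseteq> (g ^^ (2 * K)) ` ball x (\<gamma> * \<epsilon>)"
  using wieler by (auto simp: wieler_def)

section \<open>Uniform neighbourhoods\<close>

text \<open>One \<open>d < e\<close> for all coordinates makes this the open ball of the supremum
  distance, with the slack \<open>e - d\<close> that \<open>nbhd_open\<close> uses.\<close>

definition nbhd :: "(nat \<Rightarrow> 'a) \<Rightarrow> real \<Rightarrow> (nat \<Rightarrow> 'a) set" where
  "nbhd x e = {y \<in> solenoid g. \<exists>d<e. \<forall>n. dist (x n) (y n) \<le> d}"

lemma nbhd_solenoid: "y \<in> nbhd x e \<Longrightarrow> y \<in> solenoid g"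
  by (simp add: nbhd_def)

lemma nbhd_dist: "y \<in> nbhd x e \<Longrightarrow> dist (x n) (y n) < e"
  unfolding nbhd_def by (blast intro: le_less_trans)

lemma nbhd_self: "x \<in> solenoid g \<Longrightarrow> 0 < e \<Longrightarrow> x \<in> nbhd x e"
  by (auto simp: nbhd_def)

lemma nbhd_mono: "d \<le> e \<Longrightarrow> nbhd x d \<subseteq> nbhd x e"
  unfolding nbhd_def by (blast intro: less_le_trans)

lemma nbhd_min: "nbhd x (min a b) = nbhd x a \<inter> nbhd x b"
proof (cases "a \<le> b")
  case True
  then show ?thesis
    using nbhd_mono[of a b x] by (auto simp: min_def)
next
  case False
  then show ?thesis
    using nbhd_mono[of b a x] by (auto simp: min_def)
qed

lemma nbhd_triangle:
  assumes "y \<in> nbhd x a" "z \<in> nbhd x b"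
  shows "z \<in> nbhd y (a + b)"
proof -
  obtain c d where c: "c < a" "\<And>n. dist (x n) (y n) \<le> c" and d: "d < b" "\<And>n. dist (x n) (z n) \<le> d"
    using assms by (auto simp: nbhd_def)
  have "dist (y n) (z n) \<le> c + d" for n
    using c(2)[of n] d(2)[of n] dist_triangle3[of "y n" "z n" "x n"] by linarith
  with c d assms show ?thesis
    by (auto simp: nbhd_def intro!: exI[of _ "c + d"])
qed

lemma nbhd_open:
  assumes "y \<in> nbhd x e"
  obtains r where "0 < r" "nbhd y r \<subseteq> nbhd x e"
proof -
  obtain d where d: "d < e" "\<And>n. dist (x n) (y n) \<le> d"
    using assms by (auto simp: nbhd_def)
  have "z \<in> nbhd x e" if z: "z \<in> nbhd y (e - d)" for z
  proof -
    obtain c where c: "c < e - d" "\<And>n. dist (y n) (z n) \<le> c"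
      using z by (auto simp: nbhd_def)
    have "dist (x n) (z n) \<le> d + c" for n
      using c(2)[of n] d(2)[of n] dist_triangle[of "x n" "z n" "y n"] by linarith
    with c d z show ?thesis
      by (auto simp: nbhd_def intro!: exI[of _ "d + c"])
  qed
  with d show thesis
    by (intro that[of "e - d"]) auto
qed

section \<open>Uniform continuity of iterates and contraction along backward orbits\<close>

lemma continuous_pow: "continuous_on UNIV (g ^^ n)"
proof (induction n)
  case (Suc n)
  then have "continuous_on UNIV (\<lambda>x. g ((g ^^ n) x))"
    by (rule continuous_on_compose2[OF cont_g]) simp
  then show ?case by (simp add: comp_def)
qed (simp add: id_def)

text \<open>Compactness makes each iterate uniformly continuous, and finitely many moduli have a
  common minimum.\<close>

lemma pow_modulus:
  assumes "0 < e"
  obtains d where "0 < d" "\<And>x y i. dist x y < d \<Longrightarrow> i \<le> m \<Longrightarrow> dist ((g ^^ i) x) ((g ^^ i) y) < e"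
proof -
  have "\<exists>d>0. \<forall>x y. dist x y < d \<longrightarrow> (\<forall>i\<le>m. dist ((g ^^ i) x) ((g ^^ i) y) < e)"
  proof (induction m)
    case (Suc m)
    then obtain d where d: "0 < d"
      "\<And>x y i. dist x y < d \<Longrightarrow> i \<le> m \<Longrightarrow> dist ((g ^^ i) x) ((g ^^ i) y) < e"
      by blast
    have "uniformly_continuous_on UNIV (g ^^ Suc m)"
      using compact_UNIV_Y continuous_pow by (intro compact_uniformly_continuous)
    then obtain d' where d': "0 < d'"
      "\<And>x y. dist x y < d' \<Longrightarrow> dist ((g ^^ Suc m) x) ((g ^^ Suc m) y) < e"
      unfolding uniformly_continuous_on_def using assms
      by (metis UNIV_I dist_commute)
    show ?case
      using d d' by (intro exI[of _ "min d d'"]) (auto simp: le_Suc_eq)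
  qed (use assms in auto)
  with that show thesis by blast
qed

text \<open>Axiom 1 is applied to the coordinates at \<open>K * j + 2 * K\<close>: the two iterates
  land at \<open>K * j + K\<close> and \<open>K * j\<close>, so each block of \<open>K\<close>
  coordinates gains a factor \<open>\<gamma> ^ K\<close>.\<close>

lemma backward_contraction:
  assumes "x \<in> solenoid g" "y \<in> solenoid g" "\<And>n. dist (x n) (y n) \<le> \<beta>"
  shows "dist (x (K * j)) (y (K * j)) \<le> \<gamma> ^ (K * j) * dist (x 0) (y 0)"
proof (induction j)
  case (Suc j)
  have "dist (x (K * j + K)) (y (K * j + K)) \<le> \<gamma> ^ K * dist (x (K * j)) (y (K * j))"
    using axiom1[OF assms(3), of "K * j + 2 * K"]
      solenoid_pow[OF assms(1), of K "K * j + K"] solenoid_pow[OF assms(2), of K "K * j + K"]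
      solenoid_pow[OF assms(1), of "2 * K" "K * j"] solenoid_pow[OF assms(2), of "2 * K" "K * j"]
    by (simp add: mult_2 add.assoc)
  also have "\<dots> \<le> \<gamma> ^ K * (\<gamma> ^ (K * j) * dist (x 0) (y 0))"
    using Suc.IH gamma_pos by (intro mult_left_mono) auto
  finally show ?case
    by (simp add: power_add algebra_simps)
qed simp

text \<open>Contraction carries a bound on the zeroth coordinate to every multiple of
  \<open>K\<close>, and a modulus for the first \<open>K\<close> iterates fills the gaps.\<close>

lemma nbhd_control:
  assumes "0 < e"
  obtains d where "0 < d"
    "\<And>x y. x \<in> solenoid g \<Longrightarrow> y \<in> solenoid g \<Longrightarrow> (\<And>n. dist (x n) (y n) \<le> \<beta>) \<Longrightarrow>
       dist (x 0) (y 0) < d \<Longrightarrow> y \<in> nbhd x e"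
proof -
  obtain d where d: "0 < d"
    "\<And>x y i. dist x y < d \<Longrightarrow> i \<le> K \<Longrightarrow> dist ((g ^^ i) x) ((g ^^ i) y) < e / 2"
    using pow_modulus[of "e / 2" K] assms by auto
  have "y \<in> nbhd x e" if xy: "x \<in> solenoid g" "y \<in> solenoid g" "\<And>n. dist (x n) (y n) \<le> \<beta>"
    and less: "dist (x 0) (y 0) < d" for x y
  proof -
    have "dist (x n) (y n) \<le> e / 2" for n
    proof -
      obtain j where "n \<le> K * j" "K * j - n \<le> K"
        by (rule next_multiple)
      then obtain i where i: "n + i = K * j" "i \<le> K"
        using le_add_diff_inverse by blast
      have "\<gamma> ^ (K * j) * dist (x 0) (y 0) \<le> dist (x 0) (y 0)"
        using gamma_pos gamma_less by (intro mult_left_le_one_le) (auto intro: power_le_one)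
      then have "dist (x (K * j)) (y (K * j)) < d"
        using backward_contraction[OF xy, of j] less by linarith
      then show ?thesis
        using d(2)[OF _ i(2)] solenoid_pow[OF xy(1), of i n] solenoid_pow[OF xy(2), of i n]
        by (metis i(1) less_imp_le)
    qed
    with assms xy show ?thesis
      by (auto simp: nbhd_def intro!: exI[of _ "e / 2"])
  qed
  with d(1) that show thesis by blast
qed

text \<open>Equal zeroth coordinates are closer than every \<open>d\<close> from
  \<open>nbhd_control\<close>, so all coordinates are arbitrarily close: the projection is injective
  on \<open>\<beta>\<close>-close sequences.\<close>

lemma solenoid_eqI:
  assumes "x \<in> solenoid g" "y \<in> solenoid g" "\<And>n. dist (x n) (y n) \<le> \<beta>" "x 0 = y 0"
  shows "x = y"
proof
  fix n
  have "dist (x n) (y n) < e" if "0 < e" for e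
    using nbhd_control[OF that] assms nbhd_dist by (metis dist_self)
  then show "x n = y n"
    by (metis dist_pos_lt less_irrefl)
qed

lemma backward_asymptotic:
  assumes "x \<in> solenoid g" "y \<in> solenoid g" "\<And>n. dist (x n) (y n) \<le> \<beta>"
  shows "(\<lambda>n. dist (x n) (y n)) \<longlonglongrightarrow> 0"
proof (rule LIMSEQ_I)
  fix e :: real assume e: "0 < e"
  obtain d where d: "0 < d"
    "\<And>x y. x \<in> solenoid g \<Longrightarrow> y \<in> solenoid g \<Longrightarrow> (\<And>n. dist (x n) (y n) \<le> \<beta>) \<Longrightarrow>
       dist (x 0) (y 0) < d \<Longrightarrow> y \<in> nbhd x e"
    using nbhd_control[OF e] by blast
  have "\<gamma> ^ K < 1"
    using gamma_pos gamma_less K_pos by (simp add: power_Suc_less_one power_less_one_iff)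
  moreover have "0 < d / \<beta>" using d(1) beta_pos by simp
  ultimately obtain j where "(\<gamma> ^ K) ^ j < d / \<beta>"
    using real_arch_pow_inv by blast
  then have "\<gamma> ^ (K * j) * \<beta> < d"
    using beta_pos by (simp add: power_mult field_simps)
  moreover have "\<gamma> ^ (K * j) * dist (x 0) (y 0) \<le> \<gamma> ^ (K * j) * \<beta>"
    using assms(3)[of 0] gamma_pos by (intro mult_left_mono) auto
  ultimately have "dist (x (K * j)) (y (K * j)) < d"
    using backward_contraction[OF assms, of j] by linarith
  \<comment> \<open>\<open>nbhd_control\<close> is applied to the sequences started at
    \<open>K * j\<close>, whose zeroth coordinates are already \<open>d\<close>-close; this bounds
    the whole tail at once.\<close>
  then have "(\<lambda>n. y (K * j + n)) \<in> nbhd (\<lambda>n. x (K * j + n)) e"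
    using assms by (intro d(2)) (auto intro: solenoid_shift)
  then have "dist (x (K * j + n)) (y (K * j + n)) < e" for n
    using nbhd_dist by blast
  then show "\<exists>N. \<forall>n\<ge>N. norm (dist (x n) (y n) - 0) < e"
    by (intro exI[of _ "K * j"]) (metis diff_zero le_add_diff_inverse real_norm_def abs_of_nonneg zero_le_dist)
qed

section \<open>The unstable set\<close>

lemma dX'_bdd_Y: "bdd_above (range (\<lambda>n. \<gamma> ^ n * dist (x n) (y n :: 'a)))"
  using compact_imp_bounded[OF compact_UNIV_Y] gamma_pos gamma_less by (intro dX'_bdd) auto

lemma dX'_upper: "\<gamma> ^ n * dist (x n) (y n :: 'a) \<le> dX' \<gamma> x y"
  unfolding dX'_def by (rule cSUP_upper[OF UNIV_I dX'_bdd_Y])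

lemma dX'_triangle: "dX' \<gamma> x z \<le> dX' \<gamma> x y + dX' \<gamma> y (z :: nat \<Rightarrow> 'a)"
proof -
  have "\<gamma> ^ n * dist (x n) (z n) \<le> dX' \<gamma> x y + dX' \<gamma> y z" for n
  proof -
    have "\<gamma> ^ n * dist (x n) (z n) \<le> \<gamma> ^ n * (dist (x n) (y n) + dist (y n) (z n))"
      using gamma_pos by (intro mult_left_mono dist_triangle) auto
    with dX'_upper[of n x y] dX'_upper[of n y z] show ?thesis
      by (simp add: distrib_left)
  qed
  then show ?thesis
    unfolding dX'_def[of _ x z] by (intro cSUP_least) auto
qed

lemma dX_triangle: "dX g K \<gamma> x z \<le> dX g K \<gamma> x y + dX g K \<gamma> y z"
  unfolding dX_def sum.distrib[symmetric] distrib_left[symmetric]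
  using gamma_pos by (intro sum_mono mult_left_mono dX'_triangle) auto

lemma dX'_nonneg: "0 \<le> dX' \<gamma> x (y :: nat \<Rightarrow> 'a)"
  using dX'_upper[of 0 x y] by (simp add: order_trans[OF zero_le_dist])

lemma dist_le_dX: "dist (x 0) (y 0) \<le> dX g K \<gamma> x y"
proof -
  have "dX' \<gamma> x y \<le> dX g K \<gamma> x y"
    unfolding dX_def using gamma_pos dX'_nonneg
    by (intro order_trans[OF _ member_le_sum[of 0]]) auto
  with dX'_upper[of 0 x y] show ?thesis by simp
qed

text \<open>Uniform continuity lets one \<open>d\<close> serve all centres, which
  \<open>unstably_equiv_iff\<close> needs for its moving tails.\<close>

lemma nbhd_sub_Xu_loc:
  assumes "0 < e"
  obtains d where "0 < d" "\<And>x. nbhd x d \<subseteq> Xu_loc g K \<gamma> x e"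
proof -
  \<comment> \<open>The sum in \<open>dX\<close> has \<open>K + 1\<close> terms, each at most
    \<open>c\<close>, so the total stays strictly below \<open>e\<close>.\<close>
  define c where "c = e / (K + 2)"
  have c: "0 < c"
    using assms by (simp add: c_def)
  obtain d where d: "0 < d"
    "\<And>x y i. dist x y < d \<Longrightarrow> i \<le> K \<Longrightarrow> dist ((g ^^ i) x) ((g ^^ i) y) < c"
    using pow_modulus[OF c] by blast
  have "y \<in> Xu_loc g K \<gamma> x e" if y: "y \<in> nbhd x (min d e)" for x y
  proof -
    have dist: "dist (x n) (y n) < d" "dist (x n) (y n) < e" for n
      using nbhd_dist[OF y, of n] by auto
    have "\<gamma> ^ i * dX' \<gamma> ((phi g ^^ i) x) ((phi g ^^ i) y) \<le> c" if "i \<le> K" for i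
    proof -
      have "dist ((phi g ^^ i) x n) ((phi g ^^ i) y n) \<le> c" for n
        using d(2)[OF dist(1), of "i - n" 0] d(2)[OF dist(1), of 0 "n - i"] that
        by (auto simp: phi_pow_apply less_imp_le)
      then have "\<gamma> ^ n * dist ((phi g ^^ i) x n) ((phi g ^^ i) y n) \<le> c" for n
        using gamma_pos gamma_less
        by (intro order_trans[OF mult_left_le_one_le]) (auto intro: power_le_one)
      then have "dX' \<gamma> ((phi g ^^ i) x) ((phi g ^^ i) y) \<le> c"
        unfolding dX'_def by (intro cSUP_least) auto
      then show ?thesis
        using gamma_pos gamma_less dX'_nonneg
        by (intro order_trans[OF mult_left_le_one_le]) (auto intro: power_le_one)
    qed
    then have "dX g K \<gamma> x y \<le> of_nat (card {0..K}) * c"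
      unfolding dX_def by (intro sum_bounded_above) auto
    also have "\<dots> < e"
      using assms by (simp add: c_def field_simps)
    finally show ?thesis
      using dist nbhd_solenoid[OF y] by (simp add: Xu_loc_def)
  qed
  then show thesis
    using d(1) assms by (intro that[of "min d e"]) auto
qed

text \<open>Pointwise strict bounds become uniform because distances of \<open>\<beta>\<close>-close
  sequences tend to 0: all but finitely many are below \<open>e / 2\<close>, and a finite maximum
  keeps the bound strict.\<close>

lemma Xu_loc_sub_nbhd:
  assumes "x \<in> solenoid g" "0 < e" "e \<le> \<beta>"
  shows "Xu_loc g K \<gamma> x e \<subseteq> nbhd x e"
proof
  fix y assume y: "y \<in> Xu_loc g K \<gamma> x e"
  then have less: "dist (x n) (y n) < e" for n
    by (simp add: Xu_loc_def)
  have "(\<lambda>n. dist (x n) (y n)) \<longlonglongrightarrow> 0"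
    using y assms less less_le_trans[OF less assms(3)]
    by (intro backward_asymptotic) (auto simp: Xu_loc_def intro: less_imp_le)
  then obtain N where N: "\<And>n. n \<ge> N \<Longrightarrow> dist (x n) (y n) < e / 2"
    using LIMSEQ_D[of _ 0 "e / 2"] assms(2) by fastforce
  define d where "d = Max (insert (e / 2) ((\<lambda>n. dist (x n) (y n)) ` {..<N}))"
  have "d < e"
    unfolding d_def using less assms(2) by (subst Max_less_iff) auto
  moreover have "dist (x n) (y n) \<le> d" for n
  proof (cases "n < N")
    case True
    then show ?thesis
      unfolding d_def by (intro Max_ge) auto
  next
    case False
    then have "dist (x n) (y n) \<le> e / 2"
      using N[of n] by simp
    also have "\<dots> \<le> d"
      unfolding d_def by (intro Max_ge) auto
    finally show ?thesis .
  qed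
  ultimately show "y \<in> nbhd x e"
    using y by (auto simp: nbhd_def Xu_loc_def)
qed

text \<open>Both defining inequalities are strict: \<open>nbhd_open\<close> gives the slack for the
  coordinates, and \<open>e - dX g K \<gamma> x y\<close> is the slack for the metric.\<close>

lemma Xu_loc_open:
  assumes "x \<in> solenoid g" "0 < e" "e \<le> \<beta>" "y \<in> Xu_loc g K \<gamma> x e"
  obtains r where "0 < r" "nbhd y r \<subseteq> Xu_loc g K \<gamma> x e"
proof -
  obtain r where r: "0 < r" "nbhd y r \<subseteq> nbhd x e"
    using nbhd_open Xu_loc_sub_nbhd[OF assms(1-3)] assms(4) by blast
  have "0 < e - dX g K \<gamma> x y"
    using assms(4) by (simp add: Xu_loc_def)
  from nbhd_sub_Xu_loc[OF this] obtain d
    where d: "0 < d" "nbhd y d \<subseteq> Xu_loc g K \<gamma> y (e - dX g K \<gamma> x y)"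
    by metis
  have "z \<in> Xu_loc g K \<gamma> x e" if z: "z \<in> nbhd y (min r d)" for z
  proof -
    have "z \<in> nbhd x e" "z \<in> Xu_loc g K \<gamma> y (e - dX g K \<gamma> x y)"
      using z r(2) d(2) by (auto simp: nbhd_min)
    then show ?thesis
      using nbhd_dist[of z x e] dX_triangle[of x z y] by (auto simp: Xu_loc_def)
  qed
  with r(1) d(1) show thesis
    by (intro that[of "min r d"]) auto
qed

text \<open>The inverse shift drops coordinates, so the \<open>n\<close>-th distance dominates
  \<open>dist (x n) (y n)\<close>; conversely, uniformly close tails are close in
  \<open>dX\<close>.\<close>

lemma unstably_equiv_iff:
  assumes "x \<in> solenoid g" "y \<in> solenoid g"
  shows "unstably_equiv g K \<gamma> x y \<longleftrightarrow> (\<lambda>n. dist (x n) (y n)) \<longlonglongrightarrow> 0"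
proof
  let ?D = "\<lambda>n. dX g K \<gamma> (\<lambda>m. x (n + m)) (\<lambda>m. y (n + m))"
  have eq: "unstably_equiv g K \<gamma> x y \<longleftrightarrow> ?D \<longlonglongrightarrow> 0"
    by (simp add: unstably_equiv_def phi_inv_pow[OF assms(1)] phi_inv_pow[OF assms(2)])
  have le: "dist (x n) (y n) \<le> ?D n" for n
    using dist_le_dX[of "\<lambda>m. x (n + m)" "\<lambda>m. y (n + m)"] by simp
  {
    assume "unstably_equiv g K \<gamma> x y"
    then have "?D \<longlonglongrightarrow> 0" using eq by simp
    then show "(\<lambda>n. dist (x n) (y n)) \<longlonglongrightarrow> 0"
      by (rule Lim_null_comparison[rotated]) (use le in auto)
  }
  assume lim: "(\<lambda>n. dist (x n) (y n)) \<longlonglongrightarrow> 0"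
  have "?D \<longlonglongrightarrow> 0"
  proof (rule LIMSEQ_I)
    fix e :: real assume "0 < e"
    then obtain d where d: "0 < d" "\<And>x. nbhd x d \<subseteq> Xu_loc g K \<gamma> x e"
      using nbhd_sub_Xu_loc by blast
    obtain N where N: "\<And>n. n \<ge> N \<Longrightarrow> dist (x n) (y n) < d / 2"
      using LIMSEQ_D[OF lim, of "d / 2"] d(1) by fastforce
    have "norm (?D n - 0) < e" if "n \<ge> N" for n
    proof -
      have "dist (x (n + m)) (y (n + m)) \<le> d / 2" for m
        using N[of "n + m"] that by simp
      then have "(\<lambda>m. y (n + m)) \<in> nbhd (\<lambda>m. x (n + m)) d"
        using assms(2) d(1) by (auto simp: nbhd_def intro!: exI[of _ "d / 2"] solenoid_shift)
      then have "(\<lambda>m. y (n + m)) \<in> Xu_loc g K \<gamma> (\<lambda>m. x (n + m)) e"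
        using d(2) by blast
      then show ?thesis
        using order_trans[OF zero_le_dist le[of n]] by (simp add: Xu_loc_def)
    qed
    then show "\<exists>N. \<forall>n\<ge>N. norm (?D n - 0) < e" by blast
  qed
  then show "unstably_equiv g K \<gamma> x y" using eq by simp
qed

abbreviation XuP :: "(nat \<Rightarrow> 'a) set" where
  "XuP \<equiv> Xu g K \<gamma> P"

lemma Xu_iff: "x \<in> XuP \<longleftrightarrow> x \<in> solenoid g \<and> (\<exists>p\<in>P. (\<lambda>n. dist (x n) (p n)) \<longlonglongrightarrow> 0)"
  unfolding Xu_def mem_Collect_eq using unstably_equiv_iff P_solenoid by (meson subsetD)

lemma Xu_solenoid: "x \<in> XuP \<Longrightarrow> x \<in> solenoid g"
  by (simp add: Xu_iff)

text \<open>\<open>\<beta>\<close>-closeness forces backward asymptoticity, so a neighbour is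
  asymptotic to the same point of \<open>P\<close>.\<close>

lemma nbhd_sub_Xu:
  assumes "x \<in> XuP" "e \<le> \<beta>"
  shows "nbhd x e \<subseteq> XuP"
proof
  fix y assume y: "y \<in> nbhd x e"
  obtain p where p: "p \<in> P" "(\<lambda>n. dist (x n) (p n)) \<longlonglongrightarrow> 0"
    using assms(1) by (auto simp: Xu_iff)
  have "dist (x n) (y n) \<le> \<beta>" for n
    using nbhd_dist[OF y, of n] assms(2) by simp
  then have "(\<lambda>n. dist (x n) (y n)) \<longlonglongrightarrow> 0"
    using y assms(1) by (intro backward_asymptotic) (auto simp: Xu_solenoid nbhd_solenoid)
  from tendsto_add[OF this p(2)] have "(\<lambda>n. dist (x n) (y n) + dist (x n) (p n)) \<longlonglongrightarrow> 0"
    by simp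
  then have "(\<lambda>n. dist (y n) (p n)) \<longlonglongrightarrow> 0"
    by (rule Lim_null_comparison[rotated]) (simp add: dist_triangle3)
  with p y show "y \<in> XuP"
    by (auto simp: Xu_iff nbhd_solenoid)
qed

lemma phi_Xu: "x \<in> XuP \<Longrightarrow> phi g x \<in> XuP"
proof -
  assume x: "x \<in> XuP"
  then obtain p where p: "p \<in> P" "(\<lambda>n. dist (x n) (p n)) \<longlonglongrightarrow> 0"
    by (auto simp: Xu_iff)
  then have "(\<lambda>n. dist (phi g x (Suc n)) (phi g p (Suc n))) \<longlonglongrightarrow> 0"
    by (simp add: phi_def)
  then have "(\<lambda>n. dist (phi g x n) (phi g p n)) \<longlonglongrightarrow> 0"
    by (rule LIMSEQ_imp_Suc)
  then show ?thesis
    using p(1) phi_P x by (auto simp: Xu_iff phi_in_solenoid)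
qed

lemma phi_pow_Xu: "x \<in> XuP \<Longrightarrow> (phi g ^^ n) x \<in> XuP"
  by (induction n) (auto intro: phi_Xu)

lemma shift_Xu:
  assumes "x \<in> XuP"
  shows "(\<lambda>n. x (Suc n)) \<in> XuP"
proof -
  obtain p where p: "p \<in> P" "(\<lambda>n. dist (x n) (p n)) \<longlonglongrightarrow> 0"
    using assms by (auto simp: Xu_iff)
  obtain p' where p': "p' \<in> P" "p = phi g p'"
    using p(1) phi_P by blast
  have "(\<lambda>n. dist (x (Suc n)) (p (Suc n))) \<longlonglongrightarrow> 0"
    using p(2) by (rule LIMSEQ_Suc)
  then show ?thesis
    using p' assms solenoid_shift[of x g 1] by (auto simp: Xu_iff phi_def)
qed

text \<open>\<open>Xu_loc\<close> and \<open>nbhd\<close> are cofinal in each other at every centre,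
  so openness can be tested with \<open>nbhd\<close> alone.\<close>

lemma openin_Xu_iff:
  "openin (Xu_top g \<beta> K \<gamma> P) U \<longleftrightarrow> U \<subseteq> XuP \<and> (\<forall>x\<in>U. \<exists>e>0. nbhd x e \<subseteq> U)"
proof -
  have "(\<exists>e>0. e \<le> \<beta> / 2 \<and> Xu_loc g K \<gamma> x e \<subseteq> U) \<longleftrightarrow> (\<exists>e>0. nbhd x e \<subseteq> U)" if "x \<in> XuP" for x
  proof
    assume "\<exists>e>0. e \<le> \<beta> / 2 \<and> Xu_loc g K \<gamma> x e \<subseteq> U"
    then show "\<exists>e>0. nbhd x e \<subseteq> U"
      by (meson nbhd_sub_Xu_loc order_trans)
  next
    assume "\<exists>e>0. nbhd x e \<subseteq> U"
    then obtain e where e: "0 < e" "nbhd x e \<subseteq> U" by blast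
    have "Xu_loc g K \<gamma> x (min e (\<beta> / 2)) \<subseteq> nbhd x (min e (\<beta> / 2))"
      using that e beta_pos by (intro Xu_loc_sub_nbhd) (auto simp: Xu_solenoid)
    also have "\<dots> \<subseteq> U"
      using e(2) by (auto simp: nbhd_min)
    finally show "\<exists>e>0. e \<le> \<beta> / 2 \<and> Xu_loc g K \<gamma> x e \<subseteq> U"
      using e beta_pos by (intro exI[of _ "min e (\<beta> / 2)"]) auto
  qed
  then show ?thesis
    unfolding openin_Xu_top openin_Xu_def by (meson subsetD)
qed

lemma topspace_Xu_top: "topspace (Xu_top g \<beta> K \<gamma> P) = XuP"
proof -
  have "openin (Xu_top g \<beta> K \<gamma> P) XuP"
    using nbhd_sub_Xu[OF _ order_refl] beta_pos by (auto simp: openin_Xu_iff)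
  then show ?thesis
    by (meson openin_Xu_iff openin_subset openin_topspace subset_antisym)
qed

lemma openin_nbhd: "x \<in> XuP \<Longrightarrow> e \<le> \<beta> \<Longrightarrow> openin (Xu_top g \<beta> K \<gamma> P) (nbhd x e)"
  unfolding openin_Xu_iff using nbhd_sub_Xu nbhd_open by metis

section \<open>The shift and uniform neighbourhoods\<close>

lemma phi_continuous:
  assumes "0 < e"
  obtains d where "0 < d" "\<And>x. phi g ` nbhd x d \<subseteq> nbhd (phi g x) e"
proof -
  obtain d where d: "0 < d"
    "\<And>x y i. dist x y < d \<Longrightarrow> i \<le> 1 \<Longrightarrow> dist ((g ^^ i) x) ((g ^^ i) y) < e / 2"
    using pow_modulus[of "e / 2" 1] assms by auto
  have "phi g y \<in> nbhd (phi g x) e" if y: "y \<in> nbhd x d" for x y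
  proof -
    have "dist (phi g x n) (phi g y n) \<le> e / 2" for n
      using d(2)[OF nbhd_dist[OF y], of 1 0] d(2)[OF nbhd_dist[OF y], of 0 "n - 1"]
      by (auto simp: phi_def split: nat.split)
    then show ?thesis
      using assms nbhd_solenoid[OF y] by (auto simp: nbhd_def phi_in_solenoid intro!: exI[of _ "e / 2"])
  qed
  with d(1) that show thesis by blast
qed

text \<open>Deleting a coordinate cannot increase a supremum of distances, so the radius is kept;
  this makes \<open>phi g\<close> open.\<close>

lemma shift_nbhd:
  assumes "z \<in> nbhd (phi g x) e"
  shows "(\<lambda>n. z (Suc n)) \<in> nbhd x e"
proof -
  obtain d where d: "d < e" "\<And>n. dist (phi g x n) (z n) \<le> d"
    using assms by (auto simp: nbhd_def)
  have "dist (x n) (z (Suc n)) \<le> d" for n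
    using d(2)[of "Suc n"] by (simp add: phi_def)
  then show ?thesis
    using d(1) solenoid_shift[OF nbhd_solenoid[OF assms], of 1] by (auto simp: nbhd_def)
qed

section \<open>Lifting through the inverse limit\<close>

text \<open>Axiom 2 is used at ever deeper multiples of \<open>K\<close> to pull \<open>w\<close>
  back along \<open>x\<close>. The points \<open>f j\<close> need not form an orbit, but their
  images under \<open>g ^^ K\<close> form a backward orbit of \<open>g ^^ K\<close> and serve as the
  coordinates \<open>K * j\<close>; the others are filled in by applying \<open>g\<close>.\<close>

lemma lifting:
  assumes "0 < c"
  obtains \<epsilon> where "0 < \<epsilon>"
    "\<And>x w. x \<in> solenoid g \<Longrightarrow> dist (x K) w < \<epsilon> \<Longrightarrow> \<exists>y\<in>nbhd x c. y 0 = (g ^^ K) w"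
proof -
  obtain d where d: "0 < d"
    "\<And>x y i. dist x y < d \<Longrightarrow> i \<le> 2 * K \<Longrightarrow> dist ((g ^^ i) x) ((g ^^ i) y) < c / 2"
    using pow_modulus[of "c / 2" "2 * K"] assms by auto
  \<comment> \<open>\<open>\<beta>\<close> is the range of Axiom 2, and \<open>d\<close> that of the
    modulus.\<close>
  define \<epsilon> where "\<epsilon> = min d \<beta>"
  have \<epsilon>: "0 < \<epsilon>" "\<epsilon> \<le> \<beta>" "\<epsilon> \<le> d"
    using d(1) beta_pos by (auto simp: \<epsilon>_def)
  have "\<exists>y\<in>nbhd x c. y 0 = (g ^^ K) w" if x: "x \<in> solenoid g" and w: "dist (x K) w < \<epsilon>" for x w
  proof -
    have "\<exists>f. \<forall>j. (dist (x (K * j + K)) (f j) < \<epsilon> \<and> (j = 0 \<longrightarrow> f j = w)) \<and>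
             (g ^^ (2 * K)) (f (Suc j)) = (g ^^ K) (f j)"
    proof (rule dependent_nat_choice)
      show "\<exists>v. dist (x (K * 0 + K)) v < \<epsilon> \<and> ((0::nat) = 0 \<longrightarrow> v = w)"
        using w by simp
      fix v j assume "dist (x (K * j + K)) v < \<epsilon> \<and> (j = 0 \<longrightarrow> v = w)"
      then have "(g ^^ K) v \<in> (g ^^ K) ` ball ((g ^^ K) (x (K * j + K + K))) \<epsilon>"
        using solenoid_pow[OF x, of K "K * j + K"] by simp
      then obtain u where u: "u \<in> ball (x (K * j + K + K)) (\<gamma> * \<epsilon>)" "(g ^^ (2 * K)) u = (g ^^ K) v"
        using axiom2[OF \<epsilon>(1,2)] by fastforce
      \<comment> \<open>Since the radius does not grow, the same \<open>\<epsilon>\<close> works at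
        every level.\<close>
      have "\<gamma> * \<epsilon> \<le> \<epsilon>"
        using gamma_less gamma_pos \<epsilon>(1) by (intro mult_left_le_one_le) auto
      with u show "\<exists>u. (dist (x (K * Suc j + K)) u < \<epsilon> \<and> (Suc j = 0 \<longrightarrow> u = w)) \<and>
          (g ^^ (2 * K)) u = (g ^^ K) v"
        by (intro exI[of _ u]) (auto simp: algebra_simps)
    qed
    then obtain f where f: "\<And>j. dist (x (K * j + K)) (f j) < \<epsilon>" "f 0 = w"
      "\<And>j. (g ^^ (2 * K)) (f (Suc j)) = (g ^^ K) (f j)"
      by blast
    \<comment> \<open>The candidate for coordinate \<open>n\<close> computed from level
      \<open>j\<close>; it is independent of \<open>j\<close> once \<open>n \<le> K * j\<close>,
      where the truncated subtraction is exact.\<close>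
    define F where "F n j = (g ^^ (K + (K * j - n))) (f j)" for n j
    have F_Suc: "F n (Suc j) = F n j" if "n \<le> K * j" for n j
    proof -
      have "K + (K * Suc j - n) = (K * j - n) + 2 * K"
        using that by simp
      then have "F n (Suc j) = (g ^^ (K * j - n)) ((g ^^ (2 * K)) (f (Suc j)))"
        unfolding F_def by (simp only: funpow_add comp_apply)
      also have "\<dots> = (g ^^ (K * j - n + K)) (f j)"
        by (simp only: f(3) funpow_add comp_apply)
      finally show ?thesis
        by (simp only: F_def add.commute)
    qed
    have F_mono: "F n j' = F n j" if "j \<le> j'" "n \<le> K * j" for n j j'
      using that
    proof (induction j' rule: dec_induct)
      case (step m)
      have "n \<le> K * m"
        using step by (meson le_trans mult_le_mono2)
      with step show ?case by (simp add: F_Suc)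
    qed simp
    have F_eq: "F n j = F n j'" if "n \<le> K * j" "n \<le> K * j'" for n j j'
      using F_mono[of j j' n] F_mono[of j' j n] that by (cases j j' rule: linorder_le_cases) auto
    have n_le: "n \<le> K * n" for n
      using K_pos by simp
    define y where "y n = F n n" for n
    have "g (y (Suc n)) = y n" for n
    proof -
      have *: "Suc (K + (K * Suc n - Suc n)) = K + (K * Suc n - n)"
        using n_le[of "Suc n"] by simp
      have "g (F (Suc n) (Suc n)) = F n (Suc n)"
        unfolding F_def *[symmetric] by simp
      also have "\<dots> = F n n"
        by (rule F_Suc[OF n_le])
      finally show ?thesis by (simp add: y_def)
    qed
    then have y: "y \<in> solenoid g"
      by (simp add: solenoid_def)
    have "dist (x n) (y n) \<le> c / 2" for n
    proof -
      \<comment> \<open>A level within \<open>K\<close> of \<open>n\<close> keeps the exponent at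
        most \<open>2 * K\<close>, the range for which \<open>d\<close> was chosen.\<close>
      obtain j where j: "n \<le> K * j" "K * j - n \<le> K"
        by (rule next_multiple)
      have "dist (x (K * j + K)) (f j) < d"
        using f(1)[of j] \<epsilon>(3) by simp
      from d(2)[OF this, of "K + (K * j - n)"] j(2)
      have "dist ((g ^^ (K + (K * j - n))) (x (K * j + K))) (F n j) < c / 2"
        by (simp add: F_def)
      moreover have "(g ^^ (K + (K * j - n))) (x (K * j + K)) = x n"
        using solenoid_pow[OF x, of "K + (K * j - n)" n] j(1) by (simp add: add.commute add.left_commute)
      moreover have "F n j = y n"
        unfolding y_def by (rule F_eq[OF j(1) n_le])
      ultimately show ?thesis by simp
    qed
    then have "y \<in> nbhd x c"
      using y assms by (auto simp: nbhd_def intro!: exI[of _ "c / 2"])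
    moreover have "y 0 = (g ^^ K) w"
      by (simp add: y_def F_def f(2))
    ultimately show ?thesis by blast
  qed
  with \<epsilon>(1) that show thesis by blast
qed

section \<open>Germs of the projection\<close>

text \<open>Inclusion of germs of projected neighbourhoods. The target radius can be fixed at
  \<open>\<beta>\<close> because \<open>belowE\<close> recovers every smaller one.\<close>

definition below :: "(nat \<Rightarrow> 'a) \<Rightarrow> (nat \<Rightarrow> 'a) \<Rightarrow> bool" where
  "below x y \<longleftrightarrow> x \<in> solenoid g \<and> y \<in> solenoid g \<and> x 0 = y 0 \<and>
     (\<exists>\<eta>>0. \<forall>v\<in>nbhd x \<eta>. \<exists>u\<in>nbhd y \<beta>. u 0 = v 0)"

lemma belowI:
  assumes "x \<in> solenoid g" "y \<in> solenoid g" "x 0 = y 0" "0 < \<eta>"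
    "\<And>v. v \<in> nbhd x \<eta> \<Longrightarrow> \<exists>u\<in>nbhd y \<beta>. u 0 = v 0"
  shows "below x y"
  using assms unfolding below_def by blast

text \<open>The lift \<open>u\<close> has the zeroth coordinate of \<open>v\<close>, which is close
  to \<open>x 0 = y 0\<close>, so \<open>nbhd_control\<close> places \<open>u\<close> in any
  prescribed neighbourhood of \<open>y\<close>.\<close>

lemma belowE:
  assumes "below x y" "0 < c"
  obtains \<eta> where "0 < \<eta>" "\<And>v. v \<in> nbhd x \<eta> \<Longrightarrow> \<exists>u\<in>nbhd y c. u 0 = v 0"
proof -
  obtain \<eta> where \<eta>: "0 < \<eta>" "\<And>v. v \<in> nbhd x \<eta> \<Longrightarrow> \<exists>u\<in>nbhd y \<beta>. u 0 = v 0"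
    and xy: "x \<in> solenoid g" "y \<in> solenoid g" "x 0 = y 0"
    using assms(1) unfolding below_def by blast
  obtain d where d: "0 < d"
    "\<And>x y. x \<in> solenoid g \<Longrightarrow> y \<in> solenoid g \<Longrightarrow> (\<And>n. dist (x n) (y n) \<le> \<beta>) \<Longrightarrow>
       dist (x 0) (y 0) < d \<Longrightarrow> y \<in> nbhd x c"
    using nbhd_control[OF assms(2)] by blast
  have "\<exists>u\<in>nbhd y c. u 0 = v 0" if v: "v \<in> nbhd x (min \<eta> d)" for v
  proof -
    have "v \<in> nbhd x \<eta>"
      using v by (auto simp: nbhd_min)
    then obtain u where u: "u \<in> nbhd y \<beta>" "u 0 = v 0"
      using \<eta>(2) by blast
    have "dist (y 0) (u 0) < d"
      using nbhd_dist[OF v, of 0] xy u by simp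
    then have "u \<in> nbhd y c"
      using xy(2) nbhd_solenoid[OF u(1)] less_imp_le[OF nbhd_dist[OF u(1)]] by (intro d(2)) auto
    with u show ?thesis by blast
  qed
  with \<eta>(1) d(1) show thesis
    by (intro that[of "min \<eta> d"]) auto
qed

lemma below_refl: "x \<in> solenoid g \<Longrightarrow> below x x"
  using beta_pos by (intro belowI[of _ _ \<beta>]) auto

text \<open>To compose the inclusions, the target radius of the first is shrunk to the source radius
  of the second.\<close>

lemma below_trans:
  assumes "below x y" "below y z"
  shows "below x z"
proof -
  obtain c where c: "0 < c" "\<And>v. v \<in> nbhd y c \<Longrightarrow> \<exists>u\<in>nbhd z \<beta>. u 0 = v 0"
    using belowE[OF assms(2) beta_pos] by blast
  obtain \<eta> where \<eta>: "0 < \<eta>" "\<And>v. v \<in> nbhd x \<eta> \<Longrightarrow> \<exists>u\<in>nbhd y c. u 0 = v 0"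
    using belowE[OF assms(1) c(1)] by blast
  show ?thesis
    using assms \<eta>(1) by (intro belowI[of _ _ \<eta>]) (auto simp: below_def dest!: \<eta>(2) c(2))
qed

definition same_germ :: "(nat \<Rightarrow> 'a) \<Rightarrow> (nat \<Rightarrow> 'a) \<Rightarrow> bool" where
  "same_germ x y \<longleftrightarrow> below x y \<and> below y x"

lemma same_germ_0: "same_germ x y \<Longrightarrow> x 0 = y 0"
  unfolding same_germ_def below_def by blast

lemma same_germ_eqI:
  assumes "same_germ x y" "\<And>n. dist (x n) (y n) \<le> \<beta>"
  shows "x = y"
proof (rule solenoid_eqI[OF _ _ assms(2)])
  show "x \<in> solenoid g" "y \<in> solenoid g"
    using assms(1) unfolding same_germ_def below_def by blast+
  show "x 0 = y 0"
    by (rule same_germ_0[OF assms(1)])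
qed

text \<open>This will make the quotient map open. The germ inclusions between \<open>v\<close> and
  its lift \<open>u\<close> are inherited from those between \<open>x\<close> and \<open>y\<close>,
  as both points stay where these inclusions hold.\<close>

lemma same_germ_transport:
  assumes "same_germ x y" "0 < c"
  obtains \<eta> where "0 < \<eta>" "\<And>v. v \<in> nbhd x \<eta> \<Longrightarrow> \<exists>u\<in>nbhd y c. same_germ v u"
proof -
  have "0 < \<beta> / 4"
    using beta_pos by simp
  then obtain \<eta>' where \<eta>': "0 < \<eta>'" "\<And>u. u \<in> nbhd y \<eta>' \<Longrightarrow> \<exists>v\<in>nbhd x (\<beta> / 4). v 0 = u 0"
    using assms(1) belowE unfolding same_germ_def by metis
  \<comment> \<open>The bound \<open>\<eta>'\<close> keeps \<open>u\<close> where the reverse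
    inclusion holds; \<open>\<beta> / 4\<close> makes any two points of one neighbourhood
    \<open>\<beta>\<close>-close.\<close>
  define c' where "c' = min (min c (\<beta> / 4)) \<eta>'"
  have c': "0 < c'" "c' \<le> c" "c' \<le> \<beta> / 4" "c' \<le> \<eta>'"
    using assms(2) \<eta>'(1) beta_pos by (auto simp: c'_def)
  obtain \<eta> where \<eta>: "0 < \<eta>" "\<And>v. v \<in> nbhd x \<eta> \<Longrightarrow> \<exists>u\<in>nbhd y c'. u 0 = v 0"
    using assms(1) belowE[OF _ c'(1)] unfolding same_germ_def by metis
  have "\<exists>u\<in>nbhd y c. same_germ v u" if v: "v \<in> nbhd x (min \<eta> (\<beta> / 4))" for v
  proof -
    have v1: "v \<in> nbhd x \<eta>" and v2: "v \<in> nbhd x (\<beta> / 4)"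
      using v by (auto simp: nbhd_min)
    obtain u where u: "u \<in> nbhd y c'" "u 0 = v 0"
      using \<eta>(2)[OF v1] by blast
    obtain r where r: "0 < r" "nbhd v r \<subseteq> nbhd x \<eta>"
      using nbhd_open[OF v1] .
    obtain s where s: "0 < s" "nbhd u s \<subseteq> nbhd y c'"
      using nbhd_open[OF u(1)] .
    have "below v u"
    proof (rule belowI[OF nbhd_solenoid[OF v1] nbhd_solenoid[OF u(1)] u(2)[symmetric] r(1)])
      fix v' assume "v' \<in> nbhd v r"
      then obtain u' where u': "u' \<in> nbhd y c'" "u' 0 = v' 0"
        using \<eta>(2) r(2) by blast
      then show "\<exists>u\<in>nbhd u \<beta>. u 0 = v' 0"
        using nbhd_triangle[OF u(1) u'(1)] nbhd_mono[of "c' + c'" \<beta> u] c'(3) beta_pos by force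
    qed
    moreover have "below u v"
    proof (rule belowI[OF nbhd_solenoid[OF u(1)] nbhd_solenoid[OF v1] u(2) s(1)])
      fix u' assume "u' \<in> nbhd u s"
      then have "u' \<in> nbhd y \<eta>'"
        using s(2) nbhd_mono[OF c'(4), of y] by blast
      then obtain v' where v': "v' \<in> nbhd x (\<beta> / 4)" "v' 0 = u' 0"
        using \<eta>'(2) by blast
      then show "\<exists>v\<in>nbhd v \<beta>. v 0 = u' 0"
        using nbhd_triangle[OF v2 v'(1)] nbhd_mono[of "\<beta> / 4 + \<beta> / 4" \<beta> v] beta_pos by force
    qed
    ultimately show ?thesis
      using u(1) nbhd_mono[OF c'(2), of y] by (auto simp: same_germ_def)
  qed
  then show thesis
    using \<eta>(1) beta_pos by (intro that[of "min \<eta> (\<beta> / 4)"]) auto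
qed

text \<open>Dropping a coordinate of \<open>z\<close> moves the question back to \<open>x\<close>
  and \<open>y\<close>; applying \<open>phi g\<close> to the lift \<open>u\<close> found there
  recovers \<open>z 0\<close>, since \<open>g (z (Suc 0)) = z 0\<close>.\<close>

lemma below_phi:
  assumes "below x y"
  shows "below (phi g x) (phi g y)"
proof -
  obtain c where c: "0 < c" "\<And>x. phi g ` nbhd x c \<subseteq> nbhd (phi g x) \<beta>"
    using phi_continuous[OF beta_pos] by blast
  obtain \<eta> where \<eta>: "0 < \<eta>" "\<And>v. v \<in> nbhd x \<eta> \<Longrightarrow> \<exists>u\<in>nbhd y c. u 0 = v 0"
    using belowE[OF assms c(1)] by blast
  show ?thesis
  proof (rule belowI[OF _ _ _ \<eta>(1)])
    have xy: "x \<in> solenoid g" "y \<in> solenoid g" "x 0 = y 0"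
      using assms unfolding below_def by blast+
    then show "phi g x \<in> solenoid g" "phi g y \<in> solenoid g" "phi g x 0 = phi g y 0"
      by (simp_all add: phi_in_solenoid) (simp add: phi_def)
    fix z assume z: "z \<in> nbhd (phi g x) \<eta>"
    obtain u where u: "u \<in> nbhd y c" "u 0 = z (Suc 0)"
      using \<eta>(2)[OF shift_nbhd[OF z]] by auto
    have "phi g u 0 = z 0"
      using u(2) nbhd_solenoid[OF z] by (simp add: phi_def solenoid_def)
    with u(1) c(2) show "\<exists>u\<in>nbhd (phi g y) \<beta>. u 0 = z 0" by blast
  qed
qed

lemma same_germ_phi: "same_germ x y \<Longrightarrow> same_germ (phi g x) (phi g y)"
  by (simp add: same_germ_def below_phi)

text \<open>By \<open>lifting\<close>, the projection of a neighbourhood of \<open>x\<close> is governed by the image under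
  \<open>g ^^ K\<close> of a ball around \<open>x K\<close>; its radius does not depend on \<open>x\<close>, so the germ varies
  continuously with \<open>x K\<close>.\<close>

lemma germ_continuous:
  assumes "0 < c"
  obtains \<delta> where "0 < \<delta>"
    "\<And>x y. x \<in> solenoid g \<Longrightarrow> y \<in> solenoid g \<Longrightarrow> dist (x K) (y K) < \<delta> \<Longrightarrow>
       \<exists>z\<in>nbhd x c. same_germ z y"
proof -
  \<comment> \<open>With \<open>c0 + c0 \<le> \<beta>\<close>, two lifts near \<open>x\<close> are
    \<open>\<beta>\<close>-close, as needed when \<open>z\<close> replaces \<open>x\<close> as
    centre.\<close>
  define c0 where "c0 = min c (\<beta> / 2)"
  have c0: "0 < c0" "c0 \<le> c" "c0 + c0 \<le> \<beta>"
    using assms beta_pos by (auto simp: c0_def)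
  obtain \<epsilon> where \<epsilon>: "0 < \<epsilon>"
    "\<And>x w. x \<in> solenoid g \<Longrightarrow> dist (x K) w < \<epsilon> \<Longrightarrow> \<exists>y\<in>nbhd x c0. y 0 = (g ^^ K) w"
    using lifting[OF c0(1)] by blast
  have "0 < min c0 (\<epsilon> / 4)"
    using c0(1) \<epsilon>(1) by simp
  then obtain \<delta> where \<delta>: "0 < \<delta>"
    "\<And>x w. x \<in> solenoid g \<Longrightarrow> dist (x K) w < \<delta> \<Longrightarrow> \<exists>y\<in>nbhd x (min c0 (\<epsilon> / 4)). y 0 = (g ^^ K) w"
    using lifting by metis
  have "\<exists>z\<in>nbhd x c. same_germ z y"
    if xy: "x \<in> solenoid g" "y \<in> solenoid g" and less: "dist (x K) (y K) < min \<delta> (\<epsilon> / 4)" for x y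
  proof -
    have pow: "(g ^^ K) (u K) = u 0" if "u \<in> solenoid g" for u
      using solenoid_pow[OF that, of K 0] by simp
    \<comment> \<open>\<open>z\<close> lifts \<open>y K\<close> near \<open>x\<close>, so it lies
      over \<open>y 0\<close>; its closeness to \<open>x\<close> at coordinate \<open>K\<close> lets
      points near \<open>z\<close> be lifted near \<open>y\<close>.\<close>
    obtain z where z: "z \<in> nbhd x (min c0 (\<epsilon> / 4))" "z 0 = y 0"
      using \<delta>(2)[OF xy(1), of "y K"] less pow[OF xy(2)] by auto
    have z0: "z \<in> nbhd x c0"
      using z(1) by (auto simp: nbhd_min)
    have zK: "dist (x K) (z K) < \<epsilon> / 4"
      using nbhd_dist[OF z(1), of K] by simp
    have "0 < \<epsilon> / 4"
      using \<epsilon>(1) by simp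
    note bI = belowI[OF _ _ _ this]
    have "below z y"
    proof (rule bI[OF nbhd_solenoid[OF z0] xy(2) z(2)])
      fix v assume v: "v \<in> nbhd z (\<epsilon> / 4)"
      have "dist (y K) (v K) < \<epsilon>"
        using nbhd_dist[OF v, of K] zK less \<epsilon>(1) dist_triangle[of "y K" "v K" "z K"]
          dist_triangle3[of "y K" "z K" "x K"] by (simp add: dist_commute)
      then obtain u where "u \<in> nbhd y c0" "u 0 = v 0"
        using \<epsilon>(2)[OF xy(2)] pow[OF nbhd_solenoid[OF v]] by metis
      then show "\<exists>u\<in>nbhd y \<beta>. u 0 = v 0"
        using nbhd_mono[of c0 \<beta> y] c0 by auto
    qed
    moreover have "below y z"
    proof (rule bI[OF xy(2) nbhd_solenoid[OF z0] z(2)[symmetric]])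
      fix v assume v: "v \<in> nbhd y (\<epsilon> / 4)"
      have "dist (x K) (v K) < \<epsilon>"
        using nbhd_dist[OF v, of K] less \<epsilon>(1) dist_triangle[of "x K" "v K" "y K"] by simp
      then obtain u where u: "u \<in> nbhd x c0" "u 0 = v 0"
        using \<epsilon>(2)[OF xy(1)] pow[OF nbhd_solenoid[OF v]] by metis
      then show "\<exists>u\<in>nbhd z \<beta>. u 0 = v 0"
        using nbhd_triangle[OF z0 u(1)] nbhd_mono[OF c0(3), of z] by auto
    qed
    ultimately show ?thesis
      using z0 nbhd_mono[OF c0(2), of x] by (auto simp: same_germ_def)
  qed
  then show thesis
    using \<delta>(1) \<epsilon>(1) by (intro that[of "min \<delta> (\<epsilon> / 4)"]) auto
qed

text \<open>The point \<open>z\<close> near \<open>x\<close> with the germ of \<open>y\<close> lies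
  over \<open>x 0\<close>, so it is \<open>x\<close> by local injectivity.\<close>

lemma same_germ_if_eq_at_K:
  assumes "x \<in> solenoid g" "y \<in> solenoid g" "x K = y K"
  shows "same_germ x y"
proof -
  obtain \<delta> where \<delta>: "0 < \<delta>"
    "\<And>x y. x \<in> solenoid g \<Longrightarrow> y \<in> solenoid g \<Longrightarrow> dist (x K) (y K) < \<delta> \<Longrightarrow>
       \<exists>z\<in>nbhd x \<beta>. same_germ z y"
    using germ_continuous[OF beta_pos] by blast
  then obtain z where z: "z \<in> nbhd x \<beta>" "same_germ z y"
    using assms by fastforce
  have "x 0 = z 0"
    using same_germ_0[OF z(2)] solenoid_pow[OF assms(1), of K 0] solenoid_pow[OF assms(2), of K 0] assms(3)
    by simp
  then have "x = z"
    using assms(1) nbhd_solenoid[OF z(1)] less_imp_le[OF nbhd_dist[OF z(1)]] by (intro solenoid_eqI)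
  with z(2) show ?thesis by simp
qed

text \<open>Read forwards, Axiom 1 says that each block of \<open>K\<close> steps expands distances
  by the inverse of \<open>\<gamma> ^ K\<close>; a forward orbit bounded by \<open>\<beta>\<close>
  then forces the initial distance to vanish.\<close>

lemma forward_expansive:
  assumes "x \<in> solenoid g" "y \<in> solenoid g" "\<And>n. dist (x n) (y n) \<le> \<beta>"
    and fwd: "\<And>n. dist ((g ^^ n) (x 0)) ((g ^^ n) (y 0)) \<le> \<beta>"
  shows "x = y"
proof -
  \<comment> \<open>Axiom 1 needs a \<open>\<beta>\<close>-close pair one block earlier: for
    \<open>j = 0\<close> this is \<open>x K\<close>, \<open>y K\<close>, where backward closeness
    enters; for larger \<open>j\<close> it lies on the forward orbits.\<close>
  have step: "dist ((g ^^ (K * j)) (x 0)) ((g ^^ (K * j)) (y 0))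
      \<le> \<gamma> ^ K * dist ((g ^^ (K * Suc j)) (x 0)) ((g ^^ (K * Suc j)) (y 0))" for j
  proof (cases j)
    case 0
    then show ?thesis
      using axiom1[OF assms(3), of K] solenoid_pow[OF assms(1), of K 0] solenoid_pow[OF assms(2), of K 0]
      by (simp add: funpow_add mult_2)
  next
    case (Suc i)
    then show ?thesis
      using axiom1[OF fwd, of "K * i"] by (simp add: funpow_add mult_2)
  qed
  have "dist (x 0) (y 0) \<le> (\<gamma> ^ K) ^ j * dist ((g ^^ (K * j)) (x 0)) ((g ^^ (K * j)) (y 0))" for j
  proof (induction j)
    case (Suc j)
    have "(\<gamma> ^ K) ^ j * dist ((g ^^ (K * j)) (x 0)) ((g ^^ (K * j)) (y 0))
      \<le> (\<gamma> ^ K) ^ j * (\<gamma> ^ K * dist ((g ^^ (K * Suc j)) (x 0)) ((g ^^ (K * Suc j)) (y 0)))"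
      using gamma_pos by (intro mult_left_mono step) auto
    with Suc.IH show ?case
      by (simp add: algebra_simps)
  qed simp
  then have le: "dist (x 0) (y 0) \<le> (\<gamma> ^ K) ^ j * \<beta>" for j
    using gamma_pos fwd by (meson mult_left_mono order_trans zero_le_power less_imp_le)
  have "\<gamma> ^ K < 1"
    using gamma_pos gamma_less K_pos by (simp add: power_less_one_iff)
  then have "(\<lambda>j. (\<gamma> ^ K) ^ j * \<beta>) \<longlonglongrightarrow> 0 * \<beta>"
    using gamma_pos by (intro tendsto_mult LIMSEQ_power_zero tendsto_const) auto
  then have "dist (x 0) (y 0) \<le> 0"
    using le by (intro LIMSEQ_le_const) auto
  then show ?thesis
    using assms(1-3) by (intro solenoid_eqI) auto
qed

section \<open>The shift as an open continuous map of the unstable set\<close>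

lemma openin_phi_image:
  assumes "openin (Xu_top g \<beta> K \<gamma> P) U"
  shows "openin (Xu_top g \<beta> K \<gamma> P) (phi g ` U)"
  unfolding openin_Xu_iff
proof (intro conjI ballI)
  show "phi g ` U \<subseteq> XuP"
    using assms phi_Xu by (auto simp: openin_Xu_iff)
  fix y assume "y \<in> phi g ` U"
  then obtain x where x: "x \<in> U" "y = phi g x" by blast
  then obtain e where e: "0 < e" "nbhd x e \<subseteq> U"
    using assms by (auto simp: openin_Xu_iff)
  have "z \<in> phi g ` U" if z: "z \<in> nbhd y e" for z
  proof -
    have "(\<lambda>n. z (Suc n)) \<in> U"
      using shift_nbhd z x(2) e(2) by blast
    moreover have "phi g (\<lambda>n. z (Suc n)) = z"
      using phi_shift nbhd_solenoid[OF z] by blast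
    ultimately show ?thesis by (metis imageI)
  qed
  with e(1) show "\<exists>e>0. nbhd y e \<subseteq> phi g ` U" by blast
qed

lemma openin_phi_vimage:
  assumes "openin (Xu_top g \<beta> K \<gamma> P) U"
  shows "openin (Xu_top g \<beta> K \<gamma> P) {x \<in> XuP. phi g x \<in> U}"
  unfolding openin_Xu_iff
proof (intro conjI ballI)
  fix x assume "x \<in> {x \<in> XuP. phi g x \<in> U}"
  then have x: "x \<in> XuP" "phi g x \<in> U" by auto
  then obtain e where e: "0 < e" "nbhd (phi g x) e \<subseteq> U"
    using assms by (auto simp: openin_Xu_iff)
  obtain d where d: "0 < d" "phi g ` nbhd x d \<subseteq> nbhd (phi g x) e"
    using phi_continuous[OF e(1)] by metis
  have "nbhd x (min d \<beta>) \<subseteq> {x \<in> XuP. phi g x \<in> U}"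
    using nbhd_sub_Xu[OF x(1), of "min d \<beta>"] d(2) e(2) by (auto simp: nbhd_min)
  then show "\<exists>e>0. nbhd x e \<subseteq> {x \<in> XuP. phi g x \<in> U}"
    using d(1) beta_pos by (intro exI[of _ "min d \<beta>"]) auto
qed auto

end

section \<open>The quotient\<close>

locale wieler_quotient = wieler_solenoid +
  fixes \<epsilon>Y :: real
  assumes eps_pos: "0 < \<epsilon>Y" and eps_le: "\<epsilon>Y \<le> \<beta> / 2"
begin

abbreviation R :: "((nat \<Rightarrow> 'a) \<times> (nat \<Rightarrow> 'a)) set" where
  "R \<equiv> sim0 g \<beta> K \<gamma> P \<epsilon>Y"

abbreviation Q :: "(nat \<Rightarrow> 'a) set topology" where
  "Q \<equiv> Xu_mod g \<beta> K \<gamma> P \<epsilon>Y"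

abbreviation G :: "(nat \<Rightarrow> 'a) set \<Rightarrow> (nat \<Rightarrow> 'a) set" where
  "G \<equiv> g_tilde g \<beta> K \<gamma> P \<epsilon>Y"

definition cls :: "(nat \<Rightarrow> 'a) \<Rightarrow> (nat \<Rightarrow> 'a) set" where
  "cls x = R `` {x}"

text \<open>The crux is that \<open>U\<close> contains \<open>y\<close>: some \<open>u\<close> in
  \<open>U\<close> lies over \<open>x 0 = y 0\<close> and is \<open>\<beta>\<close>-close to
  \<open>y\<close>, hence equals \<open>y\<close>. Equality of the projections then gives both
  inclusions.\<close>

lemma same_germ_if_sim0:
  assumes "(x, y) \<in> R"
  shows "same_germ x y"
proof -
  obtain \<delta> U where x: "x \<in> XuP" and y: "y \<in> XuP" and eq: "x 0 = y 0"
    and \<delta>: "0 < \<delta>" "\<delta> < \<epsilon>Y" and U: "openin (Xu_top g \<beta> K \<gamma> P) U" "U \<subseteq> Xu_loc g K \<gamma> y \<epsilon>Y"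
    and proj: "pi0 ` Xu_loc g K \<gamma> x \<delta> = pi0 ` U"
    using assms by (auto simp: sim0_def)
  have sol: "x \<in> solenoid g" "y \<in> solenoid g"
    using x y Xu_solenoid by auto
  have small: "\<delta> \<le> \<beta>" "\<epsilon>Y \<le> \<beta>"
    using \<delta> eps_le beta_pos by auto
  obtain d where d: "0 < d" "\<And>x. nbhd x d \<subseteq> Xu_loc g K \<gamma> x \<delta>"
    using nbhd_sub_Xu_loc[OF \<delta>(1)] by blast
  have U_nbhd: "U \<subseteq> nbhd y \<beta>"
    using U(2) Xu_loc_sub_nbhd[OF sol(2) eps_pos small(2)] nbhd_mono[OF small(2), of y] by blast
  have loc_nbhd: "Xu_loc g K \<gamma> x \<delta> \<subseteq> nbhd x \<beta>"
    using Xu_loc_sub_nbhd[OF sol(1) \<delta>(1) small(1)] nbhd_mono[OF small(1), of x] by blast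
  have "x \<in> Xu_loc g K \<gamma> x \<delta>"
    using d(2) nbhd_self[OF sol(1) d(1)] by blast
  then have "x 0 \<in> pi0 ` U"
    unfolding proj[symmetric] pi0_def by (rule imageI)
  then obtain u where u: "u \<in> U" "u 0 = x 0"
    unfolding pi0_def by auto
  have "u \<in> nbhd y \<beta>"
    using u(1) U_nbhd by blast
  then have "y = u"
    using sol(2) eq u(2) nbhd_solenoid less_imp_le[OF nbhd_dist] by (intro solenoid_eqI) auto
  then obtain e where e: "0 < e" "nbhd y e \<subseteq> U"
    using u(1) U(1) by (auto simp: openin_Xu_iff)
  have "below x y"
  proof (rule belowI[OF sol eq d(1)])
    fix v assume "v \<in> nbhd x d"
    then have "v 0 \<in> pi0 ` U"
      using d(2) unfolding proj[symmetric] pi0_def by blast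
    then show "\<exists>u\<in>nbhd y \<beta>. u 0 = v 0"
      using U_nbhd unfolding pi0_def by fastforce
  qed
  moreover have "below y x"
  proof (rule belowI[OF sol(2,1) eq[symmetric] e(1)])
    fix v assume "v \<in> nbhd y e"
    then have "v 0 \<in> pi0 ` Xu_loc g K \<gamma> x \<delta>"
      using e(2) unfolding proj pi0_def by blast
    then show "\<exists>u\<in>nbhd x \<beta>. u 0 = v 0"
      using loc_nbhd unfolding pi0_def by fastforce
  qed
  ultimately show ?thesis
    by (simp add: same_germ_def)
qed

text \<open>The witness is the part of a small neighbourhood of \<open>y\<close> lying over the
  projection of \<open>Xu_loc g K \<gamma> x \<delta>\<close>. One inclusion makes its projection
  full, the other makes it open.\<close>

lemma sim0_if_same_germ:
  assumes x: "x \<in> XuP" and y: "y \<in> XuP" and "same_germ x y"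
  shows "(x, y) \<in> R"
proof -
  have below: "below x y" "below y x" and eq: "x 0 = y 0"
    using assms(3) same_germ_0[OF assms(3)] by (simp_all add: same_germ_def)
  have sol: "x \<in> solenoid g" "y \<in> solenoid g"
    using x y Xu_solenoid by auto
  have half: "0 < \<beta> / 2"
    using beta_pos by simp
  obtain c1 where c1: "0 < c1" "nbhd y c1 \<subseteq> Xu_loc g K \<gamma> y \<epsilon>Y"
    using nbhd_sub_Xu_loc[OF eps_pos] by metis
  obtain c2 where c2: "0 < c2" "\<And>u. u \<in> nbhd y c2 \<Longrightarrow> \<exists>v\<in>nbhd x (\<beta> / 2). v 0 = u 0"
    using belowE[OF below(2) half] by blast
  \<comment> \<open>The three bounds keep \<open>U\<close> inside the prescribed set, allow lifting
    back to \<open>x\<close>, and keep \<open>U\<close> in the unstable set.\<close>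
  define c where "c = min (min c1 c2) \<beta>"
  have c: "0 < c" "nbhd y c \<subseteq> nbhd y c1" "nbhd y c \<subseteq> nbhd y c2" "c \<le> \<beta>"
    using c1(1) c2(1) beta_pos by (auto simp: c_def nbhd_min)
  obtain \<eta> where \<eta>: "0 < \<eta>" "\<And>v. v \<in> nbhd x \<eta> \<Longrightarrow> \<exists>u\<in>nbhd y c. u 0 = v 0"
    using belowE[OF below(1) c(1)] by blast
  define \<delta> where "\<delta> = min \<eta> (\<epsilon>Y / 2)"
  have \<delta>: "0 < \<delta>" "\<delta> < \<epsilon>Y" "\<delta> \<le> \<eta>" "\<delta> \<le> \<beta> / 2" "\<delta> \<le> \<beta>"
    using \<eta>(1) eps_pos eps_le by (auto simp: \<delta>_def)
  let ?L = "Xu_loc g K \<gamma> x \<delta>"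
  have L: "?L \<subseteq> nbhd x \<delta>"
    by (rule Xu_loc_sub_nbhd[OF sol(1) \<delta>(1,5)])
  define U where "U = {u \<in> nbhd y c. u 0 \<in> pi0 ` ?L}"
  have "openin (Xu_top g \<beta> K \<gamma> P) U"
    unfolding openin_Xu_iff
  proof (intro conjI ballI)
    show "U \<subseteq> XuP"
      using nbhd_sub_Xu[OF y c(4)] by (auto simp: U_def)
    fix u assume "u \<in> U"
    then obtain v where u: "u \<in> nbhd y c" and v: "v \<in> ?L" "v 0 = u 0"
      by (auto simp: U_def pi0_def)
    obtain r where r: "0 < r" "nbhd u r \<subseteq> nbhd y c"
      using nbhd_open[OF u] .
    obtain s where s: "0 < s" "nbhd v s \<subseteq> ?L"
      using Xu_loc_open[OF sol(1) \<delta>(1,5) v(1)] .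
    obtain d where d: "0 < d"
      "\<And>x y. x \<in> solenoid g \<Longrightarrow> y \<in> solenoid g \<Longrightarrow> (\<And>n. dist (x n) (y n) \<le> \<beta>) \<Longrightarrow>
         dist (x 0) (y 0) < d \<Longrightarrow> y \<in> nbhd x s"
      using nbhd_control[OF s(1)] by blast
    have vx: "v \<in> nbhd x (\<beta> / 2)"
      using v(1) L nbhd_mono[OF \<delta>(4), of x] by blast
    \<comment> \<open>A lift of \<open>u' 0\<close> near \<open>x\<close> is
      \<open>\<beta>\<close>-close to \<open>v\<close> with zeroth coordinate \<open>d\<close>-close
      to \<open>v 0\<close>, so it falls into \<open>nbhd v s\<close> and thus into
      \<open>?L\<close>.\<close>
    have "u' \<in> U" if u': "u' \<in> nbhd u (min r d)" for u'
    proof -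
      have u'y: "u' \<in> nbhd y c"
        using u' r(2) by (auto simp: nbhd_min)
      then obtain v' where v': "v' \<in> nbhd x (\<beta> / 2)" "v' 0 = u' 0"
        using c2(2) c(3) by blast
      have "dist (v n) (v' n) \<le> \<beta>" for n
        using nbhd_dist[OF nbhd_triangle[OF vx v'(1)], of n] by simp
      moreover have "dist (v 0) (v' 0) < d"
        using nbhd_dist[OF u', of 0] v(2) v'(2) by simp
      ultimately have "v' \<in> nbhd v s"
        using nbhd_solenoid[OF vx] nbhd_solenoid[OF v'(1)] by (intro d(2)) auto
      then have "v' \<in> ?L"
        using s(2) by blast
      from imageI[OF this, of pi0] show ?thesis
        using u'y v'(2) by (simp add: U_def pi0_def)
    qed
    with r(1) d(1) show "\<exists>e>0. nbhd u e \<subseteq> U"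
      by (intro exI[of _ "min r d"]) auto
  qed
  moreover have "U \<subseteq> Xu_loc g K \<gamma> y \<epsilon>Y"
    using c(2) c1(2) by (auto simp: U_def)
  moreover have "pi0 ` ?L = pi0 ` U"
  proof
    show "pi0 ` ?L \<subseteq> pi0 ` U"
    proof
      fix a assume a: "a \<in> pi0 ` ?L"
      then obtain v where v: "v \<in> ?L" "a = v 0"
        by (auto simp: pi0_def)
      then have "v \<in> nbhd x \<eta>"
        using L nbhd_mono[OF \<delta>(3), of x] by blast
      then obtain u where u: "u \<in> nbhd y c" "u 0 = v 0"
        using \<eta>(2) by blast
      then have "u \<in> U"
        using a v(2) by (simp add: U_def)
      from imageI[OF this, of pi0] show "a \<in> pi0 ` U"
        using u(2) v(2) by (simp add: pi0_def)
    qed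
  qed (auto simp: U_def pi0_def)
  ultimately show ?thesis
    using x y eq \<delta>(1,2) unfolding sim0_def by blast
qed

lemma sim0_iff: "(x, y) \<in> R \<longleftrightarrow> x \<in> XuP \<and> y \<in> XuP \<and> same_germ x y"
proof
  assume R: "(x, y) \<in> R"
  then have "x \<in> XuP" "y \<in> XuP"
    unfolding sim0_def by blast+
  then show "x \<in> XuP \<and> y \<in> XuP \<and> same_germ x y"
    using same_germ_if_sim0[OF R] by blast
qed (blast intro: sim0_if_same_germ)

lemma equiv_sim0: "equiv XuP R"
proof (rule equivI)
  show "R \<subseteq> XuP \<times> XuP"
    by (auto simp: sim0_iff)
  show "refl_on XuP R"
    by (auto simp: refl_on_def sim0_iff same_germ_def below_refl Xu_solenoid)
  show "sym R"
    by (auto simp: sym_def sim0_iff same_germ_def)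
  show "trans R"
    unfolding trans_def sim0_iff same_germ_def using below_trans by blast
qed

lemma cls_eq_iff: "x \<in> XuP \<Longrightarrow> y \<in> XuP \<Longrightarrow> cls x = cls y \<longleftrightarrow> same_germ x y"
  unfolding cls_def using eq_equiv_class_iff[OF equiv_sim0] sim0_iff by simp

lemma topspace_Q: "topspace Q = cls ` XuP"
  unfolding Xu_mod_def topspace_quotient_topology topspace_Xu_top quotient_def cls_def by auto

lemma openin_Q: "openin Q V \<longleftrightarrow> V \<subseteq> cls ` XuP \<and> openin (Xu_top g \<beta> K \<gamma> P) {x \<in> XuP. cls x \<in> V}"
  unfolding Xu_mod_def openin_quotient_topology topspace_Xu_top
  using topspace_Q[unfolded Xu_mod_def topspace_quotient_topology topspace_Xu_top]
  by (simp add: cls_def)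

text \<open>By \<open>same_germ_transport\<close>, saturations of open sets are open.\<close>

lemma openin_cls_image:
  assumes "openin (Xu_top g \<beta> K \<gamma> P) U"
  shows "openin Q (cls ` U)"
proof -
  have U: "U \<subseteq> XuP"
    using assms by (simp add: openin_Xu_iff)
  have "openin (Xu_top g \<beta> K \<gamma> P) {x \<in> XuP. cls x \<in> cls ` U}"
    unfolding openin_Xu_iff
  proof (intro conjI ballI)
    fix x assume "x \<in> {x \<in> XuP. cls x \<in> cls ` U}"
    then obtain y where x: "x \<in> XuP" and y: "y \<in> U" "cls x = cls y" by blast
    then have germ: "same_germ x y"
      using cls_eq_iff U by blast
    obtain c where c: "0 < c" "nbhd y c \<subseteq> U"
      using y(1) assms by (auto simp: openin_Xu_iff)
    obtain \<eta> where \<eta>: "0 < \<eta>" "\<And>v. v \<in> nbhd x \<eta> \<Longrightarrow> \<exists>u\<in>nbhd y c. same_germ v u"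
      using same_germ_transport[OF germ c(1)] by blast
    have "v \<in> {x \<in> XuP. cls x \<in> cls ` U}" if v: "v \<in> nbhd x (min \<eta> \<beta>)" for v
    proof -
      have vX: "v \<in> XuP"
        using v nbhd_sub_Xu[OF x, of "min \<eta> \<beta>"] by auto
      obtain u where u: "u \<in> U" "same_germ v u"
        using v \<eta>(2) c(2) by (fastforce simp: nbhd_min)
      then have "cls v = cls u"
        using cls_eq_iff[OF vX] U by blast
      with vX u(1) show ?thesis by blast
    qed
    then show "\<exists>e>0. nbhd x e \<subseteq> {x \<in> XuP. cls x \<in> cls ` U}"
      using \<eta>(1) beta_pos by (intro exI[of _ "min \<eta> \<beta>"]) auto
  qed auto
  with U show ?thesis
    unfolding openin_Q by blast
qed

section \<open>The induced map on the quotient\<close>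

lemma G_cls:
  assumes "x \<in> XuP"
  shows "G (cls x) = cls (phi g x)"
proof -
  \<comment> \<open>The shift preserves equality of germs, so every representative contributes the
    same class to the union in \<open>g_tilde_def\<close>.\<close>
  have "R `` {phi g y} = R `` {phi g x}" if "(x, y) \<in> R" for y
    using that cls_eq_iff[of "phi g y" "phi g x"] same_germ_phi
    by (auto simp: sim0_iff cls_def phi_Xu same_germ_def)
  moreover have "(x, x) \<in> R"
    using assms by (simp add: sim0_iff same_germ_def below_refl Xu_solenoid)
  ultimately show ?thesis
    unfolding g_tilde_def cls_def by blast
qed

lemma G_pow_cls: "x \<in> XuP \<Longrightarrow> (G ^^ n) (cls x) = cls ((phi g ^^ n) x)"
  by (induction n) (simp_all add: G_cls phi_pow_Xu)

lemma r_map_cls: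
  assumes "x \<in> XuP"
  shows "r_map (cls x) = x 0"
proof -
  have "x \<in> cls x"
    using assms by (simp add: cls_def sim0_iff same_germ_def below_refl Xu_solenoid)
  moreover have "pi0 y = x 0" if "y \<in> cls x" for y
    using same_germ_0[of x y] that by (simp add: cls_def pi0_def sim0_iff)
  ultimately have "pi0 ` cls x = {x 0}"
    by (metis image_constant image_cong)
  then show ?thesis
    by (simp add: r_map_def)
qed

lemma G_surj: "G ` topspace Q = topspace Q"
proof
  show "G ` topspace Q \<subseteq> topspace Q"
    by (auto simp: topspace_Q G_cls phi_Xu)
  show "topspace Q \<subseteq> G ` topspace Q"
  proof
    fix c assume "c \<in> topspace Q"
    then obtain x where x: "x \<in> XuP" "c = cls x"
      by (auto simp: topspace_Q)
    then have "c = G (cls (\<lambda>n. x (Suc n)))"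
      by (simp add: G_cls shift_Xu phi_shift Xu_solenoid)
    then show "c \<in> G ` topspace Q"
      using shift_Xu[OF x(1)] by (auto simp: topspace_Q)
  qed
qed

lemma continuous_G: "continuous_map Q Q G"
  unfolding continuous_map_def
proof (intro conjI allI impI)
  show "G \<in> topspace Q \<rightarrow> topspace Q"
    by (simp only: image_subset_iff_funcset[symmetric] G_surj order_refl)
  fix V assume V: "openin Q V"
  have "{x \<in> XuP. cls x \<in> {c \<in> topspace Q. G c \<in> V}} = {x \<in> XuP. phi g x \<in> {x \<in> XuP. cls x \<in> V}}"
    by (auto simp: topspace_Q G_cls phi_Xu)
  moreover have "openin (Xu_top g \<beta> K \<gamma> P) {x \<in> XuP. phi g x \<in> {x \<in> XuP. cls x \<in> V}}"
    using V by (intro openin_phi_vimage) (simp add: openin_Q)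
  ultimately show "openin Q {c \<in> topspace Q. G c \<in> V}"
    unfolding openin_Q by (simp add: topspace_Q)
qed

lemma openin_G_image:
  assumes "openin Q V"
  shows "openin Q (G ` V)"
proof -
  let ?U = "{x \<in> XuP. cls x \<in> V}"
  have "V = cls ` ?U"
    using assms by (auto simp: openin_Q)
  then have "G ` V = (\<lambda>x. G (cls x)) ` ?U"
    by (metis image_image)
  also have "\<dots> = cls ` phi g ` ?U"
    by (auto simp: G_cls image_image intro!: image_cong)
  finally show ?thesis
    using assms openin_cls_image openin_phi_image by (simp add: openin_Q)
qed

text \<open>The induced map is continuous and open, so only local injectivity remains.\<close>

lemma local_homeo_G: "local_homeomorphism_map Q Q G"
  unfolding local_homeomorphism_map_def
proof
  fix c assume "c \<in> topspace Q"
  then obtain x where x: "x \<in> XuP" "c = cls x"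
    by (auto simp: topspace_Q)
  have half: "0 < \<beta> / 2"
    using beta_pos by simp
  obtain d where d: "0 < d" "phi g ` nbhd x d \<subseteq> nbhd (phi g x) (\<beta> / 2)"
    using phi_continuous[OF half] by metis
  \<comment> \<open>The shifts of points of \<open>W\<close> are \<open>\<beta>\<close>-close to
    each other, so two with the same germ coincide, and injectivity of \<open>phi g\<close> cancels
    the shift.\<close>
  define W where "W = nbhd x (min d \<beta>)"
  have W: "openin (Xu_top g \<beta> K \<gamma> P) W" "W \<subseteq> XuP" "x \<in> W"
    unfolding W_def using openin_nbhd[OF x(1)] nbhd_sub_Xu[OF x(1)] nbhd_self[OF Xu_solenoid[OF x(1)]]
      d(1) beta_pos by simp_all
  let ?U = "cls ` W"
  have U: "openin Q ?U"
    by (rule openin_cls_image[OF W(1)])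
  have inj: "inj_on G ?U"
  proof (rule inj_onI, elim imageE)
    fix a b u v assume eq: "G a = G b" and a: "a = cls u" "u \<in> W" and b: "b = cls v" "v \<in> W"
    have mem: "u \<in> XuP" "v \<in> XuP"
      using a b W(2) by auto
    have "same_germ (phi g u) (phi g v)"
      using eq a b mem by (simp add: G_cls phi_Xu cls_eq_iff)
    moreover have "dist (phi g u n) (phi g v n) \<le> \<beta>" for n
    proof -
      have "phi g u \<in> nbhd (phi g x) (\<beta> / 2)" "phi g v \<in> nbhd (phi g x) (\<beta> / 2)"
        using a(2) b(2) d(2) by (auto simp: W_def nbhd_min)
      from nbhd_dist[OF nbhd_triangle[OF this], of n] show ?thesis by simp
    qed
    ultimately have "phi g u = phi g v"
      by (rule same_germ_eqI)
    then have "u = v"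
      using bij_betw_phi[of g] mem by (meson Xu_solenoid bij_betw_def inj_onD)
    with a b show "a = b" by simp
  qed
  have "homeomorphic_map (subtopology Q ?U) (subtopology Q (G ` ?U)) G"
  proof (rule bijective_open_imp_homeomorphic_map)
    show "continuous_map (subtopology Q ?U) (subtopology Q (G ` ?U)) G"
      using continuous_map_from_subtopology[OF continuous_G]
      by (auto simp: continuous_map_in_subtopology)
    show "open_map (subtopology Q ?U) (subtopology Q (G ` ?U)) G"
      unfolding open_map_def
    proof (intro allI impI)
      fix V assume "openin (subtopology Q ?U) V"
      then have "openin Q V" "V \<subseteq> ?U"
        using U openin_open_subtopology by blast+
      then show "openin (subtopology Q (G ` ?U)) (G ` V)"
        using openin_G_image U by (simp add: openin_open_subtopology image_mono)
    qed
    have "?U \<subseteq> topspace Q"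
      using U openin_subset by blast
    then show "G ` topspace (subtopology Q ?U) = topspace (subtopology Q (G ` ?U))"
      using G_surj by auto
    show "inj_on G (topspace (subtopology Q ?U))"
      using inj by (auto intro: inj_on_subset)
  qed
  then show "\<exists>U. c \<in> U \<and> openin Q U \<and> openin Q (G ` U) \<and>
      homeomorphic_map (subtopology Q U) (subtopology Q (G ` U)) G"
    using U openin_G_image[OF U] imageI[OF W(3), of cls] x(2) by (intro exI[of _ ?U]) simp
qed

section \<open>Compactness, expansivity and fibres of the projection\<close>

lemma cls_eq_if_eq_at_K: "x \<in> XuP \<Longrightarrow> y \<in> XuP \<Longrightarrow> x K = y K \<Longrightarrow> cls x = cls y"
  by (simp add: cls_eq_iff same_germ_if_eq_at_K Xu_solenoid)

lemma compact_Q: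
  assumes surj: "\<And>y. \<exists>x\<in>XuP. x 0 = y"
  shows "compact_space Q"
proof -
  define rep where "rep a = (SOME x. x \<in> XuP \<and> x 0 = a)" for a
  have rep: "rep a \<in> XuP" "rep a 0 = a" for a
    using someI_ex[of "\<lambda>x. x \<in> XuP \<and> x 0 = a"] surj[of a] unfolding rep_def by auto
  \<comment> \<open>The \<open>K\<close>-fold shift moves the chosen zeroth coordinate to position
    \<open>K\<close>. The choice \<open>rep\<close> need not be continuous;
    \<open>germ_continuous\<close> makes \<open>s\<close> continuous all the same.\<close>
  define lift where "lift a = (phi g ^^ K) (rep a)" for a
  have lift: "lift a \<in> XuP" "lift a K = a" for a
    by (simp_all add: lift_def phi_pow_Xu rep phi_pow_at)
  define s where "s a = cls (lift a)" for a
  have "continuous_map euclidean Q s"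
    unfolding continuous_map_def
  proof (intro conjI allI impI)
    show "s \<in> topspace euclidean \<rightarrow> topspace Q"
      by (simp add: s_def topspace_Q lift)
    fix V assume V: "openin Q V"
    have "\<exists>e>0. \<forall>b. dist b a < e \<longrightarrow> s b \<in> V" if a: "s a \<in> V" for a
    proof -
      have "lift a \<in> {x \<in> XuP. cls x \<in> V}"
        using a lift by (simp add: s_def)
      then obtain c where c: "0 < c" "nbhd (lift a) c \<subseteq> {x \<in> XuP. cls x \<in> V}"
        using V unfolding openin_Q openin_Xu_iff by blast
      obtain \<delta> where \<delta>: "0 < \<delta>"
        "\<And>x y. x \<in> solenoid g \<Longrightarrow> y \<in> solenoid g \<Longrightarrow> dist (x K) (y K) < \<delta> \<Longrightarrow>
           \<exists>z\<in>nbhd x c. same_germ z y"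
        using germ_continuous[OF c(1)] by blast
      have "s b \<in> V" if "dist b a < \<delta>" for b
      proof -
        have "dist (lift a K) (lift b K) < \<delta>"
          using that by (simp add: lift dist_commute)
        then obtain z where z: "z \<in> nbhd (lift a) c" "same_germ z (lift b)"
          using \<delta>(2) lift Xu_solenoid by metis
        then have "z \<in> XuP" "cls z \<in> V"
          using c(2) by auto
        moreover have "cls z = s b"
          using z(2) \<open>z \<in> XuP\<close> lift by (simp add: s_def cls_eq_iff)
        ultimately show ?thesis by simp
      qed
      with \<delta>(1) show ?thesis by blast
    qed
    then show "openin euclidean {a \<in> topspace euclidean. s a \<in> V}"
      by (simp add: open_dist)
  qed
  moreover have "compactin euclidean (UNIV :: 'a set)"
    using compact_UNIV_Y by simp
  ultimately have "compactin Q (range s)"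
    by (rule image_compactin[rotated])
  moreover have "range s = topspace Q"
  proof
    show "topspace Q \<subseteq> range s"
    proof
      fix c assume "c \<in> topspace Q"
      then obtain x where x: "x \<in> XuP" "c = cls x"
        by (auto simp: topspace_Q)
      then have "c = s (x K)"
        using cls_eq_if_eq_at_K[OF x(1) lift(1)] lift(2) by (simp add: s_def)
      then show "c \<in> range s" by simp
    qed
  qed (auto simp: s_def topspace_Q lift)
  ultimately show ?thesis
    by (simp add: compact_space_def)
qed

lemma expansive_G:
  assumes "compact_space Q"
  shows "forward_orbit_expansive Q G"
proof -
  let ?B = "\<lambda>x. cls ` nbhd x (\<beta> / 2)"
  have half: "0 < \<beta> / 2" "\<beta> / 2 \<le> \<beta>"
    using beta_pos by auto
  have open_B: "openin Q (?B x)" if "x \<in> XuP" for x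
    using that half by (intro openin_cls_image openin_nbhd)
  have cover: "topspace Q \<subseteq> \<Union> (?B ` XuP)"
    unfolding topspace_Q using nbhd_self[OF Xu_solenoid half(1)] by blast
  obtain \<U> where \<U>: "finite \<U>" "\<U> \<subseteq> ?B ` XuP" "topspace Q \<subseteq> \<Union> \<U>"
    using assms[unfolded compact_space_alt, rule_format, OF conjI[OF _ cover]] open_B by blast
  have open_\<U>: "\<forall>U\<in>\<U>. openin Q U"
    using \<U>(2) open_B by blast
  have "a = b" if ab: "a \<in> topspace Q" "b \<in> topspace Q"
    and orbit: "\<And>n. \<exists>U\<in>\<U>. (G ^^ n) a \<in> U \<and> (G ^^ n) b \<in> U" for a b
  proof -
    \<comment> \<open>The close representatives may change with \<open>n\<close>;
      \<open>r_map\<close> ties their zeroth coordinates to the orbits of the initial pair.\<close>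
    have close: "\<exists>u\<in>XuP. \<exists>v\<in>XuP. (G ^^ n) a = cls u \<and> (G ^^ n) b = cls v \<and> (\<forall>m. dist (u m) (v m) \<le> \<beta>)" for n
    proof -
      obtain z where z: "z \<in> XuP" "(G ^^ n) a \<in> ?B z" "(G ^^ n) b \<in> ?B z"
        using orbit[of n] \<U>(2) by blast
      obtain u v where uv: "u \<in> nbhd z (\<beta> / 2)" "v \<in> nbhd z (\<beta> / 2)"
        "(G ^^ n) a = cls u" "(G ^^ n) b = cls v"
        using z(2,3) by blast
      have "dist (u m) (v m) \<le> \<beta>" for m
        using nbhd_dist[OF nbhd_triangle[OF uv(1,2)], of m] by simp
      then show ?thesis
        using uv nbhd_sub_Xu[OF z(1) half(2)] by blast
    qed
    obtain x y where xy: "x \<in> XuP" "y \<in> XuP" "a = cls x" "b = cls y" "\<And>m. dist (x m) (y m) \<le> \<beta>"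
      using close[of 0] by auto
    have "dist ((g ^^ n) (x 0)) ((g ^^ n) (y 0)) \<le> \<beta>" for n
    proof -
      obtain u v where uv: "u \<in> XuP" "v \<in> XuP" "cls ((phi g ^^ n) x) = cls u"
        "cls ((phi g ^^ n) y) = cls v" "dist (u 0) (v 0) \<le> \<beta>"
        using close[of n] xy G_pow_cls by metis
      have "(phi g ^^ n) x 0 = u 0" "(phi g ^^ n) y 0 = v 0"
        using r_map_cls uv xy phi_pow_Xu by metis+
      with uv(5) show ?thesis
        by (simp add: phi_pow_0)
    qed
    then have "x = y"
      using xy by (intro forward_expansive) (auto simp: Xu_solenoid)
    with xy show ?thesis by simp
  qed
  moreover have "\<Union> \<U> = topspace Q"
    using \<U>(3) open_\<U> openin_subset by blast
  ultimately show ?thesis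
    unfolding forward_orbit_expansive_def
    using assms continuous_G G_surj \<U>(1) open_\<U> by blast
qed

text \<open>The \<open>K\<close>-fold shift puts the common zeroth coordinate at position
  \<open>K\<close>, which determines the class; the assumed point over \<open>y\<close> makes the
  image nonempty.\<close>

lemma singleton_G_K:
  assumes "\<exists>x\<in>XuP. x 0 = y"
  shows "is_singleton ((G ^^ K) ` {c \<in> topspace Q. r_map c = y})"
proof -
  obtain x where x: "x \<in> XuP" "x 0 = y"
    using assms by blast
  have "(G ^^ K) c = cls ((phi g ^^ K) x)" if c: "c \<in> topspace Q" "r_map c = y" for c
  proof -
    obtain z where z: "z \<in> XuP" "c = cls z"
      using c(1) by (auto simp: topspace_Q)
    then have "z 0 = x 0"
      using c(2) x(2) r_map_cls by simp
    then show ?thesis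
      using cls_eq_if_eq_at_K[OF phi_pow_Xu[OF z(1), of K] phi_pow_Xu[OF x(1), of K]] z
      by (simp add: G_pow_cls phi_pow_at)
  qed
  moreover have "cls x \<in> {c \<in> topspace Q. r_map c = y}"
    using x by (simp add: topspace_Q r_map_cls)
  ultimately have "(G ^^ K) ` {c \<in> topspace Q. r_map c = y} = {cls ((phi g ^^ K) x)}"
    by blast
  then show ?thesis
    by simp
qed

end

theorem theorem3p10:
  fixes g :: "'a::metric_space \<Rightarrow> 'a" and \<beta> \<gamma> \<epsilon>Y :: real and K :: nat
    and P :: "(nat \<Rightarrow> 'a) set"
  assumes "wieler g \<beta> K \<gamma>"
    and "finite P" and "P \<subseteq> solenoid g" and "phi g ` P = P"
    and "\<forall>p\<in>P. \<exists>n>0. (phi g ^^ n) p = p"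
    and "0 < \<epsilon>Y" and "\<epsilon>Y \<le> \<beta> / 2"
    and "\<forall>z\<in>Xu g K \<gamma> P. inj_on pi0 (Xu_loc g K \<gamma> z \<epsilon>Y)"
    and r_surj: "r_map ` topspace (Xu_mod g \<beta> K \<gamma> P \<epsilon>Y) = UNIV"
  shows "forward_orbit_expansive (Xu_mod g \<beta> K \<gamma> P \<epsilon>Y) (g_tilde g \<beta> K \<gamma> P \<epsilon>Y) \<and>
    local_homeomorphism_map (Xu_mod g \<beta> K \<gamma> P \<epsilon>Y) (Xu_mod g \<beta> K \<gamma> P \<epsilon>Y)
      (g_tilde g \<beta> K \<gamma> P \<epsilon>Y) \<and>
    (\<exists>L::nat. \<forall>y. is_singleton
      ((g_tilde g \<beta> K \<gamma> P \<epsilon>Y ^^ L) ` {c \<in> topspace (Xu_mod g \<beta> K \<gamma> P \<epsilon>Y). r_map c = y}))"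
proof -
  interpret wieler_quotient g \<beta> K \<gamma> P \<epsilon>Y
    using assms by unfold_locales auto
  \<comment> \<open>Surjectivity of \<open>r_map\<close> in terms of representatives supplies both
    the section used for compactness and a point in each fibre.\<close>
  have surj: "\<exists>x\<in>XuP. x 0 = y" for y
  proof -
    have "y \<in> r_map ` cls ` XuP"
      using r_surj topspace_Q by simp
    then show ?thesis
      using r_map_cls by fastforce
  qed
  show ?thesis
    using expansive_G[OF compact_Q[OF surj]] local_homeo_G singleton_G_K[OF surj] by blast
qed

end
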